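(* Let $A_1,\ldots,A_m$ be real symmetric $d\times d$ matrices, and let $P_1,\ldots,P_m$ be independent random permutation matrices, each realizable by swaps. Then for every $k\le d$, with nonzero probability, $$ \lambda_k\left(\sum_{i=1}^m P_i A_i P_i^T\right)\le \lambda_k\left(\mathbb{E}\,\chi_x\!\left(\sum_{i=1}^m P_i A_i P_i^T\right)\right).$$
   Context: $\chi_x(X)=\det(xI-X)$ is the characteristic polynomial of $X$. A random swap is a matrix-valued random variable which, for some fixed pair of distinct indices $s,t$ and some $\alpha\in[0,1]$, equals the permutation matrix of the transposition of $s$ and $t$ with probability $\alpha$ and the identity with probability $1-\alpha$. A random permutation matrix $P$ is realizable by swaps if there are independent random swaps $S_1,\ldots,S_N$ such that $P$ has the same distribution as $S_NS_{N-1}\cdots S_1$. For a symmetric matrix, $\lambda_k$ denotes its $k$-th largest eigenvalue; for a real-rooted polynomial, $\lambda_k$ denotes its $k$-th largest root (the expected polynomial on the right is real-rooted). *)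

theory Defs
  imports "HOL-Probability.Probability" "HOL-Computational_Algebra.Polynomial"
begin

definition charpoly :: "real^'n^'n \<Rightarrow> real poly" where
  "charpoly A = det (mat [:0, 1:] - map_matrix (\<lambda>a. [:a:]) A)"

lemma poly_det: "poly (det B) x = det (map_matrix (\<lambda>p. poly p x) B)"
  by (simp add: det_def poly_sum poly_prod of_int_poly)

lemma poly_charpoly: "poly (charpoly A) x = det (mat x - A)"
proof -
  have "map_matrix (\<lambda>p. poly p x) (mat [:0, 1:] - map_matrix (\<lambda>a. [:a:]) A) = mat x - A"
    by (simp add: vec_eq_iff mat_def)
  then show ?thesis
    by (simp add: charpoly_def poly_det)
qed

lemma degree_charpoly_le: "degree (charpoly (A :: real^'n^'n)) \<le> CARD('n)"
proof -
  have "degree (\<Prod>i\<in>UNIV. (mat [:0, 1:] - map_matrix (\<lambda>a. [:a:]) A) $ i $ p i) \<le> CARD('n)" for p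
  proof (rule order_trans[OF degree_prod_sum_le])
    have "(\<Sum>i\<in>UNIV. degree ((mat [:0, 1:] - map_matrix (\<lambda>a. [:a:]) A) $ i $ p i)) \<le> (\<Sum>i\<in>(UNIV::'n set). 1)"
      by (intro sum_mono) (auto simp: mat_def)
    then show "sum (degree \<circ> (\<lambda>i. (mat [:0, 1:] - map_matrix (\<lambda>a. [:a:]) A) $ i $ p i)) UNIV \<le> CARD('n)"
      by simp
  qed auto
  then show ?thesis
    unfolding charpoly_def det_def of_int_poly
    by (intro degree_sum_le) (auto intro: order_trans[OF degree_smult_le])
qed

text \<open>
  The real roots are counted with multiplicity and \<open>k\<close> starts at 1. The value is meaningful for
  \<open>1 \<le> k \<le> size (proots p)\<close>; if \<open>p\<close> is real-rooted, this is \<open>1 \<le> k \<le> degree p\<close>.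
\<close>
definition kth_largest_root :: "nat \<Rightarrow> real poly \<Rightarrow> real" where
  "kth_largest_root k p = rev (sorted_list_of_multiset (proots p)) ! (k - 1)"

definition kth_largest_eigenvalue :: "nat \<Rightarrow> real^'n^'n \<Rightarrow> real" where
  "kth_largest_eigenvalue k A = kth_largest_root k (charpoly A)"

text \<open>
  Coefficientwise expectation. The argument of \<^const>\<open>Abs_poly\<close> is a legitimate coefficient
  sequence whenever the degrees of the random polynomial are bounded, as they are for
  characteristic polynomials of matrices of a fixed size.
\<close>
definition expected_poly :: "'a measure \<Rightarrow> ('a \<Rightarrow> real poly) \<Rightarrow> real poly" where
  "expected_poly M p = Abs_poly (\<lambda>j. \<integral>\<omega>. coeff (p \<omega>) j \<partial>M)"

lemma coeff_expected_poly:
  assumes "\<And>\<omega>. degree (p \<omega>) \<le> D"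
  shows "coeff (expected_poly M p) j = (\<integral>\<omega>. coeff (p \<omega>) j \<partial>M)"
proof -
  have "coeff (p \<omega>) i = 0" if "i > D" for \<omega> i
    using assms[of \<omega>] that by (intro coeff_eq_0) auto
  then have "\<forall>i>D. (\<integral>\<omega>. coeff (p \<omega>) i \<partial>M) = 0"
    by simp
  then show ?thesis
    unfolding expected_poly_def by (subst coeff_Abs_poly) auto
qed

lemma coeff_expected_charpoly:
  "coeff (expected_poly M (\<lambda>\<omega>. charpoly (X \<omega>))) j = (\<integral>\<omega>. coeff (charpoly (X \<omega>)) j \<partial>M)"
  using degree_charpoly_le by (rule coeff_expected_poly)

definition perm_matrix :: "('n \<Rightarrow> 'n) \<Rightarrow> real^'n^'n" where
  "perm_matrix \<sigma> = (\<chi> i j. if i = \<sigma> j then 1 else 0)"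

definition random_permutation_matrix :: "'a measure \<Rightarrow> ('a \<Rightarrow> real^'n^'n) \<Rightarrow> bool" where
  "random_permutation_matrix M P \<longleftrightarrow>
     P \<in> borel_measurable M \<and> (\<forall>\<omega>\<in>space M. \<exists>\<sigma>. bij \<sigma> \<and> P \<omega> = perm_matrix \<sigma>)"

definition random_swap :: "'a measure \<Rightarrow> ('a \<Rightarrow> real^'n^'n) \<Rightarrow> bool" where
  "random_swap M S \<longleftrightarrow>
     S \<in> borel_measurable M \<and>
     (\<exists>s t \<alpha>. s \<noteq> t \<and> 0 \<le> \<alpha> \<and> \<alpha> \<le> 1 \<and>
        measure M {\<omega>\<in>space M. S \<omega> = perm_matrix (Transposition.transpose s t)} = \<alpha> \<and>
        measure M {\<omega>\<in>space M. S \<omega> = mat 1} = 1 - \<alpha>)"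

primrec swap_product :: "(nat \<Rightarrow> real^'n^'n) \<Rightarrow> nat \<Rightarrow> real^'n^'n" where
  "swap_product S 0 = mat 1"
| "swap_product S (Suc N) = S (Suc N) ** swap_product S N"

text \<open>
  The swaps need not live on the probability space of \<open>P\<close>. Since a definition cannot quantify
  over the type of their sample space, that type is fixed to \<open>nat \<Rightarrow> real^'n^'n\<close>, which carries the
  joint law of any finite family of random matrices; the lemma below shows that this loses
  no generality. The case \<open>N = 0\<close> (the constant identity) is included.
\<close>
definition realizable_by_swaps :: "'a measure \<Rightarrow> ('a \<Rightarrow> real^'n^'n) \<Rightarrow> bool" where
  "realizable_by_swaps M P \<longleftrightarrow>
     (\<exists>(N::nat) (Q :: (nat \<Rightarrow> real^'n^'n) measure) (S :: nat \<Rightarrow> (nat \<Rightarrow> real^'n^'n) \<Rightarrow> real^'n^'n).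
        prob_space Q \<and>
        prob_space.indep_vars Q (\<lambda>_. borel) S {1..N} \<and>
        (\<forall>i\<in>{1..N}. random_swap Q (S i)) \<and>
        distr M borel P = distr Q borel (\<lambda>\<omega>. swap_product (\<lambda>i. S i \<omega>) N))"

lemma swap_product_cong:
  "(\<And>i. 1 \<le> i \<Longrightarrow> i \<le> N \<Longrightarrow> S i = T i) \<Longrightarrow> swap_product S N = swap_product T N"
  by (induction N) auto

lemma realizable_by_swapsI:
  fixes S :: "nat \<Rightarrow> 'b \<Rightarrow> real^'n^'n"
  assumes Q: "prob_space Q"
    and ind: "prob_space.indep_vars Q (\<lambda>_. borel) S {1..N}"
    and swap: "\<And>i. i \<in> {1..N} \<Longrightarrow> random_swap Q (S i)"
    and eq: "distr M borel P = distr Q borel (\<lambda>\<omega>. swap_product (\<lambda>i. S i \<omega>) N)"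
  shows "realizable_by_swaps M P"
proof -
  interpret prob_space Q by (fact Q)
  define B where "B = PiM {1..N} (\<lambda>_. borel :: (real^'n^'n) measure)"
  define J where "J = (\<lambda>\<omega>. \<lambda>i\<in>{1..N}. S i \<omega>)"
  define T where "T = (\<lambda>i (f :: nat \<Rightarrow> real^'n^'n). f i)"
  have rv: "S i \<in> borel_measurable Q" if "i \<in> {1..N}" for i
    using swap[OF that] by (simp add: random_swap_def)
  have J: "J \<in> measurable Q B"
    unfolding B_def J_def by (intro measurable_restrict rv)
  have T: "T i \<in> borel_measurable B" if "i \<in> {1..N}" for i
    unfolding B_def T_def using that by (rule measurable_component_singleton)
  have TJ: "T i (J \<omega>) = S i \<omega>" if "i \<in> {1..N}" for i \<omega>
    using that by (simp add: T_def J_def)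
  let ?Q = "distr Q B J"
  interpret Q': prob_space ?Q by (rule prob_space_distr[OF J])
  have T': "T i \<in> borel_measurable ?Q" if "i \<in> {1..N}" for i
    using T[OF that] by simp
  have meas: "measure ?Q {f\<in>space ?Q. T i f = C} = measure Q {\<omega>\<in>space Q. S i \<omega> = C}"
    if "i \<in> {1..N}" for i C
  proof -
    have "{f\<in>space B. T i f = C} \<in> sets B"
      using T[OF that] by measurable
    moreover have "J -` {f\<in>space B. T i f = C} \<inter> space Q = {\<omega>\<in>space Q. S i \<omega> = C}"
      using TJ[OF that] measurable_space[OF J] by auto
    ultimately show ?thesis
      using measure_distr[OF J, of "{f\<in>space B. T i f = C}"] by simp
  qed
  have swap': "random_swap ?Q (T i)" if "i \<in> {1..N}" for i
    using swap[OF that] T'[OF that] unfolding random_swap_def meas[OF that] by blast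
  have ind': "Q'.indep_vars (\<lambda>_. borel) T {1..N}"
  proof (cases "N = 0")
    case True
    then show ?thesis
      by (simp add: Q'.indep_vars_def2 Q'.indep_sets_def)
  next
    case False
    then have ne: "{1..N} \<noteq> {}" by simp
    have 1: "distr Q (PiM {1..N} (\<lambda>_. borel)) (\<lambda>\<omega>. \<lambda>i\<in>{1..N}. S i \<omega>)
        = PiM {1..N} (\<lambda>i. distr Q borel (S i))"
      using ind rv by (subst (asm) indep_vars_iff_distr_eq_PiM'[OF ne]) auto
    have 2: "distr ?Q borel (T i) = distr Q borel (S i)" if "i \<in> {1..N}" for i
      using TJ[OF that] by (subst distr_distr[OF T[OF that] J]) (simp add: comp_def)
    have 3: "distr ?Q (PiM {1..N} (\<lambda>_. borel)) (\<lambda>f. \<lambda>i\<in>{1..N}. T i f) = ?Q"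
    proof -
      have "(\<lambda>f. \<lambda>i\<in>{1..N}. T i f) \<in> measurable B (PiM {1..N} (\<lambda>_. borel))"
        by (intro measurable_restrict T)
      then show ?thesis
        by (subst distr_distr[OF _ J])
           (auto simp: comp_def B_def J_def T_def cong: restrict_cong intro!: distr_cong)
    qed
    have 4: "PiM {1..N} (\<lambda>i. distr ?Q borel (T i)) = PiM {1..N} (\<lambda>i. distr Q borel (S i))"
      by (rule PiM_cong[OF refl 2])
    show ?thesis
    proof (subst Q'.indep_vars_iff_distr_eq_PiM'[OF ne T'])
      show "distr ?Q (PiM {1..N} (\<lambda>_. borel)) (\<lambda>f. \<lambda>i\<in>{1..N}. T i f)
          = PiM {1..N} (\<lambda>i. distr ?Q borel (T i))"
        unfolding 3 4 using 1 unfolding B_def J_def .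
    qed
  qed
  have prod_meas: "(\<lambda>f. swap_product (\<lambda>i. T i f) n) \<in> borel_measurable B" if "n \<le> N" for n
    using that
  proof (induction n)
    case (Suc n)
    have "T (Suc n) \<in> borel_measurable B" using Suc.prems by (intro T) auto
    moreover have "continuous_on UNIV (\<lambda>x :: (real^'n^'n) \<times> (real^'n^'n). fst x ** snd x)"
      unfolding matrix_matrix_mult_def by (intro continuous_intros)
    ultimately show ?case
      using Suc by (simp add: borel_measurable_continuous_Pair[where H = "(**)"])
  qed simp
  have "distr ?Q borel (\<lambda>f. swap_product (\<lambda>i. T i f) N)
      = distr Q borel (\<lambda>\<omega>. swap_product (\<lambda>i. S i \<omega>) N)"
    unfolding distr_distr[OF prod_meas[OF order_refl] J] comp_def
    using TJ by (intro distr_cong refl swap_product_cong) auto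
  then show ?thesis
    unfolding realizable_by_swaps_def
    using Q'.prob_space_axioms ind' swap' eq by (intro exI[of _ N] exI[of _ ?Q] exI[of _ T]) auto
qed

end

theory Submission
  imports Defs "HOL-Computational_Algebra.Fundamental_Theorem_Algebra"
begin

text \<open>
  Call a map \<open>p\<close> from tuples of symmetric matrices to monic real polynomials determinant-like if its
  values have no roots in the upper half plane and adding \<open>t w w\<^sup>T\<close> to one of the matrices changes \<open>p\<close>
  by \<open>t r\<close>, where \<open>r\<close> has a negative coefficient in degree \<open>d - 1\<close>. Then \<open>r / p\<close> is zero or has
  positive imaginary part on the upper half plane. If \<open>T\<close> is a transposition matrix, \<open>A\<close> and \<open>T A T\<close> are
  rank-one perturbations \<open>B + u u\<^sup>T\<close> and \<open>B + v v\<^sup>T\<close> of one matrix \<open>B\<close>, so a convex combination of the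
  two values of \<open>p\<close> is \<open>p\<close> at \<open>B\<close> times \<open>1 + c\<close> with \<open>c = 0\<close> or \<open>Im c > 0\<close>. Hence averaging over a
  random swap preserves determinant-likeness, starting with the characteristic polynomial of the sum.
  Since all convex combinations of the two values are real-rooted, one of them has its \<open>k\<close>-th root at
  most that of the average, and revealing the swaps one at a time gives the claim.
\<close>

subsection \<open>Roots of convex combinations\<close>

text \<open>Non-real roots of a real polynomial come in conjugate pairs, so this is real-rootedness
  of a nonzero polynomial. The half-plane form gives access to imaginary parts of quotients.\<close>

definition upper_stable :: "real poly \<Rightarrow> bool" where
  "upper_stable p \<longleftrightarrow> (\<forall>z. Im z > 0 \<longrightarrow> poly (map_poly complex_of_real p) z \<noteq> 0)"

lemma map_poly_of_real_mult:
  "map_poly complex_of_real (p * q) = map_poly complex_of_real p * map_poly complex_of_real q"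
  by (rule poly_eqI) (simp add: coeff_map_poly coeff_mult)

lemma map_poly_of_real_add:
  "map_poly complex_of_real (p + q) = map_poly complex_of_real p + map_poly complex_of_real q"
  by (rule poly_eqI) (simp add: coeff_map_poly)

lemma map_poly_of_real_diff:
  "map_poly complex_of_real (p - q) = map_poly complex_of_real p - map_poly complex_of_real q"
  by (rule poly_eqI) (simp add: coeff_map_poly)

lemma map_poly_of_real_smult:
  "map_poly complex_of_real (smult c p) = smult (complex_of_real c) (map_poly complex_of_real p)"
  by (rule poly_eqI) (simp add: coeff_map_poly)

lemmas map_poly_of_real = map_poly_of_real_mult map_poly_of_real_add map_poly_of_real_diff
  map_poly_of_real_smult

lemma map_poly_of_real_prod_mset:
  "map_poly complex_of_real (\<Prod>x\<in>#X. f x) = (\<Prod>x\<in>#X. map_poly complex_of_real (f x))"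
  by (induction X) (simp_all add: map_poly_of_real_mult)

lemma upper_stable_not_0: "upper_stable p \<Longrightarrow> p \<noteq> 0"
  by (auto simp: upper_stable_def dest: spec[of _ \<i>])

text \<open>Neither a complex root nor its conjugate can lie in the upper half plane, so the root
  given by the fundamental theorem of algebra is real. Dividing it off keeps stability and lowers
  the degree.\<close>

lemma upper_stable_splits:
  assumes "upper_stable p"
  shows "p = smult (lead_coeff p) (\<Prod>a\<in>#proots p. [:-a, 1:])"
  using assms
proof (induction "degree p" arbitrary: p)
  case 0
  then obtain c where "p = [:c:]" by (metis degree_0_id)
  then show ?case by simp
next
  case (Suc n)
  let ?P = "map_poly complex_of_real p"
  have "degree ?P = degree p"
    by (intro degree_map_poly) simp
  then have "\<not> constant (poly ?P)"
    using Suc.hyps(2) by (simp add: constant_degree)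
  then obtain z where z: "poly ?P z = 0"
    using fundamental_theorem_of_algebra by blast
  have "poly ?P (cnj z) = 0"
    using z by (subst real_poly_cnj_root_iff) (auto simp: coeff_map_poly)
  then have "\<not> Im z > 0" "\<not> Im (cnj z) > 0"
    using z Suc.prems by (auto simp: upper_stable_def)
  then obtain a where a: "z = complex_of_real a"
    by (intro that[of "Re z"]) (simp add: complex_eq_iff)
  have "poly ?P (complex_of_real a) = complex_of_real (poly p a)"
    by (simp add: poly_altdef coeff_map_poly degree_map_poly)
  then have "[:-a, 1:] dvd p"
    using z a by (simp add: poly_eq_0_iff_dvd[symmetric])
  then obtain q where q: "p = [:-a, 1:] * q" ..
  have p0: "p \<noteq> 0" using Suc.prems by (rule upper_stable_not_0)
  then have q0: "q \<noteq> 0" using q by auto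
  have "degree p = Suc (degree q)"
    using q q0 degree_mult_eq[of "[:-a, 1:]" q] by (simp del: mult_pCons_left)
  moreover have "upper_stable q"
    using Suc.prems unfolding upper_stable_def q map_poly_of_real_mult by auto
  ultimately have IH: "q = smult (lead_coeff q) (\<Prod>a\<in>#proots q. [:-a, 1:])"
    using Suc.hyps by simp
  have "proots p = add_mset a (proots q)"
    using p0 unfolding q by (subst proots_mult) auto
  moreover have "lead_coeff p = lead_coeff q"
    unfolding q by (subst lead_coeff_mult) simp
  ultimately have "smult (lead_coeff p) (\<Prod>a\<in>#proots p. [:-a, 1:])
      = [:-a, 1:] * smult (lead_coeff q) (\<Prod>a\<in>#proots q. [:-a, 1:])"
    by (simp only: image_mset_add_mset prod_mset.add_mset mult_smult_right)
  then show ?case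
    using IH q by simp
qed

lemma upper_stable_size_proots:
  assumes "upper_stable p"
  shows "size (proots p) = degree p"
proof -
  have "degree (\<Prod>a\<in>#X. [:-a, 1:]) = size X" for X :: "real multiset"
  proof (induction X)
    case (add x X)
    have "(\<Prod>a\<in>#X. [:-a, 1:]) \<noteq> (0 :: real poly)"
      by (auto simp: prod_mset_zero_iff)
    then show ?case using add
      by (simp add: degree_mult_eq del: mult_pCons_left)
  qed simp
  moreover have "degree p = degree (\<Prod>a\<in>#proots p. [:-a, 1:])"
    using upper_stable_splits[OF assms] upper_stable_not_0[OF assms]
    by (metis degree_smult_eq leading_coeff_0_iff)
  ultimately show ?thesis by simp
qed

section \<open>Arguments of real-rooted polynomials along vertical rays\<close>

text \<open>For \<open>u > 0\<close> the number \<open>c + i/u - a\<close> has argument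
  \<open>pi / 2 - arctan (u * (c - a))\<close>; the quarter turns are split off. The far end of the
  ray is \<open>u = 0\<close>, where the sum is continuous with value 0.\<close>

definition angle_sum :: "real multiset \<Rightarrow> real \<Rightarrow> real \<Rightarrow> real" where
  "angle_sum X c u = (\<Sum>a\<in>#X. arctan (u * (c - a)))"

lemma complex_eq_cis_arctan:
  assumes "u > 0"
  shows "Complex d (1 / u) = of_real (cmod (Complex d (1 / u))) * \<i> * cis (- arctan (u * d))"
proof -
  have n: "cmod (Complex d (1 / u)) = sqrt (1 + (u * d)\<^sup>2) / u"
  proof -
    have "d\<^sup>2 + (1 / u)\<^sup>2 = (1 + (u * d)\<^sup>2) / u\<^sup>2"
      using assms by (simp add: field_simps power2_eq_square)
    then show ?thesis
      using assms by (simp add: cmod_def real_sqrt_divide)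
  qed
  have "1 + (u * d)\<^sup>2 > 0"
    by (intro add_pos_nonneg) auto
  then have "sqrt (1 + (u * d)\<^sup>2) \<noteq> 0" by simp
  then show ?thesis
    unfolding n using assms
    by (simp add: complex_eq_iff cos_arctan sin_arctan)
qed

text \<open>Polar forms multiply and their angles add. The factor \<open>\<i> ^ size X\<close>
  depends on the degree alone, so it is common to polynomials of equal degree.\<close>

lemma prod_linear_polar:
  assumes "u > 0"
  shows "\<exists>R>0. (\<Prod>a\<in>#X. Complex (c - a) (1 / u)) = of_real R * \<i> ^ size X * cis (- angle_sum X c u)"
proof (induction X)
  case empty
  then show ?case by (intro exI[of _ 1]) (simp add: angle_sum_def)
next
  case (add x X)
  then obtain R where R: "R > 0"
    "(\<Prod>a\<in>#X. Complex (c - a) (1 / u)) = of_real R * \<i> ^ size X * cis (- angle_sum X c u)" by auto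
  define r where "r = cmod (Complex (c - x) (1 / u))"
  have "r > 0" using assms by (simp add: r_def complex_eq_iff)
  have "(\<Prod>a\<in>#add_mset x X. Complex (c - a) (1 / u))
     = (of_real r * \<i> * cis (- arctan (u * (c - x)))) * (of_real R * \<i> ^ size X * cis (- angle_sum X c u))"
    unfolding r_def using complex_eq_cis_arctan[OF assms, of "c - x"] R(2) by simp
  also have "\<dots> = of_real (r * R) * \<i> ^ size (add_mset x X) *
      (cis (- arctan (u * (c - x))) * cis (- angle_sum X c u))"
    by simp
  also have "cis (- arctan (u * (c - x))) * cis (- angle_sum X c u) = cis (- angle_sum (add_mset x X) c u)"
    unfolding cis_mult by (simp add: angle_sum_def)
  finally show ?case
    using \<open>r > 0\<close> R(1) by (intro exI[of _ "r * R"]) simp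
qed

definition roots_above :: "real poly \<Rightarrow> real \<Rightarrow> nat" where
  "roots_above p c = size {#a \<in># proots p. a > c#}"

text \<open>A summand tends to \<open>- (pi / 2)\<close> for a root above \<open>c\<close> and to
  \<open>pi / 2\<close> for one below; for a root at \<open>c\<close> it would stay 0.\<close>

lemma tendsto_angle_sum:
  assumes "c \<notin># X"
  shows "(angle_sum X c \<longlongrightarrow> pi / 2 * (real (size X) - 2 * real (size {#a \<in># X. a > c#}))) at_top"
  using assms
proof (induction X)
  case empty
  then show ?case by (simp add: angle_sum_def[abs_def])
next
  case (add x X)
  have "((\<lambda>u. arctan (u * (c - x))) \<longlongrightarrow> (if x > c then - (pi/2) else pi/2)) at_top"
  proof (cases "x > c")
    case True
    have "filterlim (\<lambda>u. u * (c - x)) at_bot at_top"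
      using True by (intro filterlim_tendsto_neg_mult_at_bot[OF tendsto_const _ filterlim_ident, of "c - x", 
            unfolded mult.commute[of "c - x"]]) auto
    then show ?thesis
      using True filterlim_compose[OF tendsto_arctan_at_bot] by simp
  next
    case False
    then have "c - x > 0" using add.prems by auto
    then have "filterlim (\<lambda>u. u * (c - x)) at_top at_top"
      by (intro filterlim_tendsto_pos_mult_at_top[OF tendsto_const _ filterlim_ident, of "c - x", 
            unfolded mult.commute[of "c - x"]]) auto
    then show ?thesis
      using False filterlim_compose[OF tendsto_arctan_at_top] by simp
  qed
  from tendsto_add[OF this add.IH]
  have "((\<lambda>u. arctan (u * (c - x)) + angle_sum X c u) \<longlongrightarrow> (if x > c then - (pi/2) else pi/2) +
      pi / 2 * (real (size X) - 2 * real (size {#a \<in># X. a > c#}))) at_top"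
    using add.prems by simp
  also have "(if x > c then - (pi/2) else pi/2) +
      pi / 2 * (real (size X) - 2 * real (size {#a \<in># X. a > c#}))
      = pi / 2 * (real (size (add_mset x X)) - 2 * real (size {#a \<in># add_mset x X. a > c#}))"
    by (simp add: field_simps)
  also have "(\<lambda>u. arctan (u * (c - x)) + angle_sum X c u) = angle_sum (add_mset x X) c"
    by (simp add: angle_sum_def fun_eq_iff)
  finally show ?case .
qed

text \<open>Each root above \<open>c\<close> contributes one negative factor \<open>c - a\<close>.
  Signs thus determine the parity of the root count.\<close>

lemma sgn_poly_roots_above:
  assumes "upper_stable p" "lead_coeff p = 1" "poly p c \<noteq> 0"
  shows "sgn (poly p c) = (- 1) ^ roots_above p c"
proof -
  have "sgn (poly (\<Prod>a\<in>#X. [:-a, 1:]) c) = (- 1) ^ size {#a \<in># X. a > c#}" if "c \<notin># X" for X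
    using that by (induction X) (auto simp: sgn_mult simp del: mult_pCons_left)
  moreover have "p = (\<Prod>a\<in>#proots p. [:-a, 1:])"
    using upper_stable_splits[OF assms(1)] assms(2) by simp
  moreover have "c \<notin># proots p"
    using assms by (auto simp: upper_stable_not_0)
  ultimately show ?thesis
    unfolding roots_above_def by metis
qed

lemma poly_upper_polar:
  assumes "upper_stable p" "lead_coeff p = 1" "u > 0"
  shows "\<exists>R>0. poly (map_poly complex_of_real p) (Complex c (1 / u))
      = of_real R * \<i> ^ degree p * cis (- angle_sum (proots p) c u)"
proof -
  have "p = (\<Prod>a\<in>#proots p. [:-a, 1:])"
    using upper_stable_splits[OF assms(1)] assms(2) by simp
  then have "map_poly complex_of_real p = (\<Prod>a\<in>#proots p. map_poly complex_of_real [:-a, 1:])"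
    by (metis map_poly_of_real_prod_mset)
  moreover have "poly (\<Prod>a\<in>#X. map_poly complex_of_real [:-a, 1:]) z = (\<Prod>a\<in>#X. z - of_real a)" for X z
    by (induction X) (simp_all add: map_poly_pCons del: mult_pCons_left)
  ultimately have "poly (map_poly complex_of_real p) (Complex c (1 / u))
      = (\<Prod>a\<in>#proots p. Complex c (1 / u) - of_real a)" by simp
  also have "\<dots> = (\<Prod>a\<in>#proots p. Complex (c - a) (1 / u))"
    by (intro arg_cong[where f = prod_mset] image_mset_cong) (simp add: complex_eq_iff)
  finally show ?thesis
    using prod_linear_polar[OF assms(3), where X = "proots p" and c = c] upper_stable_size_proots[OF assms(1)] by simp
qed

text \<open>
  Along the ray \<open>c + i/u\<close> the difference of the arguments of \<open>f\<close> and \<open>h\<close> never reaches \<open>\<plusminus>\<pi>\<close>, since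
  otherwise a convex combination would vanish. It starts at \<open>0\<close> for \<open>u = 0\<close> and tends to \<open>\<pi>\<close> times the
  difference of the root counts, which is even because \<open>f c\<close> and \<open>h c\<close> have the same sign.
\<close>
lemma roots_above_homotopy:
  fixes f h :: "real poly"
  assumes stable: "\<And>t. 0 \<le> t \<Longrightarrow> t \<le> 1 \<Longrightarrow> upper_stable (smult (1 - t) f + smult t h)"
    and monic: "lead_coeff f = 1" "lead_coeff h = 1" "degree f = degree h"
    and c: "poly f c * poly h c > 0"
  shows "roots_above f c = roots_above h c"
proof -
  have f: "upper_stable f" and h: "upper_stable h"
    using stable[of 0] stable[of 1] by auto
  define \<phi> where "\<phi> u = angle_sum (proots h) c u - angle_sum (proots f) c u" for u
  have ne: "cos (\<phi> u) \<noteq> - 1" if u: "u > 0" for u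
  proof
    assume cos: "cos (\<phi> u) = - 1"
    then have "sin (\<phi> u) = 0"
      using sin_cos_squared_add[of "\<phi> u"] by simp
    obtain R where R: "R > 0" "poly (map_poly complex_of_real f) (Complex c (1 / u))
      = of_real R * \<i> ^ degree f * cis (- angle_sum (proots f) c u)"
      using poly_upper_polar[OF f monic(1) u] by blast
    obtain R' where R': "R' > 0" "poly (map_poly complex_of_real h) (Complex c (1 / u))
      = of_real R' * \<i> ^ degree f * cis (- angle_sum (proots h) c u)"
      using poly_upper_polar[OF h monic(2) u] monic(3) by metis
    have "cis (- angle_sum (proots f) c u) = cis (\<phi> u) * cis (- angle_sum (proots h) c u)"
      unfolding cis_mult by (simp add: \<phi>_def)
    also have "cis (\<phi> u) = - 1"
      using cos \<open>sin (\<phi> u) = 0\<close> by (simp add: complex_eq_iff)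
    finally have opp: "cis (- angle_sum (proots f) c u) = - cis (- angle_sum (proots h) c u)"
      by simp
    \<comment> \<open>The two values point in opposite directions; this weight balances their moduli
      \<open>R\<close> and \<open>R'\<close>, so that the combination vanishes.\<close>
    define t where "t = R / (R + R')"
    have t: "0 \<le> t" "t \<le> 1" "(1 - t) * R = t * R'"
      using R(1) R'(1) by (auto simp: t_def field_simps)
    have "poly (map_poly complex_of_real (smult (1 - t) f + smult t h)) (Complex c (1 / u))
       = of_real (t * R' - (1 - t) * R) * \<i> ^ degree f * cis (- angle_sum (proots h) c u)"
      by (simp add: map_poly_of_real R(2) R'(2) opp algebra_simps)
    also have "\<dots> = 0" using t(3) by simp
    finally show False
      using stable[OF t(1,2)] u by (auto simp: upper_stable_def)
  qed
  have cont: "continuous_on UNIV \<phi>"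
  proof -
    have "continuous_on UNIV (angle_sum X c)" for X
      unfolding angle_sum_def[abs_def] by (induction X) (auto intro!: continuous_intros)
    then show ?thesis unfolding \<phi>_def[abs_def] by (intro continuous_intros) auto
  qed
  have "\<phi> 0 = 0" by (simp add: \<phi>_def angle_sum_def)
  have bound: "\<bar>\<phi> u\<bar> < pi" if "u > 0" for u
  proof (rule ccontr)
    assume "\<not> \<bar>\<phi> u\<bar> < pi"
    moreover have "continuous_on {0..u} (\<lambda>u. \<bar>\<phi> u\<bar>)"
      using cont by (intro continuous_intros) (auto intro: continuous_on_subset)
    ultimately obtain v where v: "0 \<le> v" "v \<le> u" "\<bar>\<phi> v\<bar> = pi"
      using IVT'[of "\<lambda>u. \<bar>\<phi> u\<bar>" 0 pi u] \<open>\<phi> 0 = 0\<close> \<open>u > 0\<close> by auto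
    have "v \<noteq> 0" using v(3) \<open>\<phi> 0 = 0\<close> by auto
    have "cos (\<phi> v) = cos \<bar>\<phi> v\<bar>" by (simp add: abs_if)
    then show False using ne[of v] v \<open>v \<noteq> 0\<close> by simp
  qed
  have nz: "poly f c \<noteq> 0" "poly h c \<noteq> 0" using c by auto
  have "(\<phi> \<longlongrightarrow> pi / 2 * (real (degree h) - 2 * real (roots_above h c)) -
      pi / 2 * (real (degree f) - 2 * real (roots_above f c))) at_top"
    unfolding \<phi>_def[abs_def] roots_above_def upper_stable_size_proots[OF f, symmetric]
      upper_stable_size_proots[OF h, symmetric]
    using nz upper_stable_not_0[OF f] upper_stable_not_0[OF h]
    by (intro tendsto_diff tendsto_angle_sum) auto
  also have "pi / 2 * (real (degree h) - 2 * real (roots_above h c)) -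
      pi / 2 * (real (degree f) - 2 * real (roots_above f c)) = pi * (real (roots_above f c) - real (roots_above h c))"
    using monic(3) by (simp add: field_simps)
  finally have lim: "(\<phi> \<longlongrightarrow> pi * (real (roots_above f c) - real (roots_above h c))) at_top" .
  \<comment> \<open>In the limit the strict bound becomes weak, so the counts may still differ by 1;
    the parity given by the signs at \<open>c\<close> excludes this.\<close>
  have "\<bar>pi * (real (roots_above f c) - real (roots_above h c))\<bar> \<le> pi"
    using bound by (intro tendsto_upperbound[OF tendsto_rabs[OF lim]])
      (auto intro!: eventually_at_top_linorderI[of 1] less_imp_le)
  then have "\<bar>real (roots_above f c) - real (roots_above h c)\<bar> \<le> 1"
    by (simp add: abs_mult)
  then have "roots_above f c \<le> roots_above h c + 1" "roots_above h c \<le> roots_above f c + 1"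
    by linarith+
  moreover have "(- 1 :: real) ^ roots_above f c = (- 1) ^ roots_above h c"
  proof -
    have "sgn (poly f c) = sgn (poly h c)"
      using c by (auto simp: zero_less_mult_iff)
    then show ?thesis
      using sgn_poly_roots_above[OF f monic(1) nz(1)] sgn_poly_roots_above[OF h monic(2) nz(2)] by simp
  qed
  then have "even (roots_above f c) \<longleftrightarrow> even (roots_above h c)"
    by (auto simp: minus_one_power_iff split: if_splits)
  ultimately show ?thesis
    by presburger
qed

section \<open>The k-th largest root in terms of root counts\<close>

text \<open>In the descending list the entries above \<open>c\<close> form an initial segment.
  Positions start at 0, so the entry at \<open>k - 1\<close> belongs to it exactly when its length
  is at least \<open>k\<close>.\<close>

lemma kth_largest_root_less_iff:
  assumes "1 \<le> k" "k \<le> size (proots p)"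
  shows "c < kth_largest_root k p \<longleftrightarrow> k \<le> roots_above p c"
proof -
  define xs where "xs = rev (sorted_list_of_multiset (proots p))"
  have len: "length xs = size (proots p)"
    by (simp add: xs_def flip: size_mset)
  have ra: "roots_above p c = length (filter (\<lambda>x. x > c) xs)"
    unfolding roots_above_def xs_def
    by (metis mset_filter mset_rev mset_sorted_list_of_multiset size_mset)
  have sorted: "sorted_wrt (\<ge>) xs"
    unfolding xs_def sorted_wrt_rev using sorted_sorted_list_of_multiset[of "proots p"] by simp
  have mono: "xs ! i \<ge> xs ! j" if "i \<le> j" "j < length xs" for i j
    using sorted that by (cases "i = j") (auto simp: sorted_wrt_iff_nth_less)
  have "length (filter (\<lambda>x. x > c) xs) = card {i. i < length xs \<and> xs ! i > c}"
    by (rule length_filter_conv_card)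
  moreover have "c < xs ! (k - 1) \<longleftrightarrow> k \<le> card {i. i < length xs \<and> xs ! i > c}"
  proof
    assume "c < xs ! (k - 1)"
    have "xs ! i > c" if "i < k" for i
      using assms mono[of i "k - 1"] \<open>c < xs ! (k - 1)\<close> that by (force simp: len)
    then have "{..<k} \<subseteq> {i. i < length xs \<and> xs ! i > c}"
      using assms by (auto simp: len)
    then show "k \<le> card {i. i < length xs \<and> xs ! i > c}"
      using card_mono[of "{i. i < length xs \<and> xs ! i > c}" "{..<k}"] by simp
  next
    assume k: "k \<le> card {i. i < length xs \<and> xs ! i > c}"
    show "c < xs ! (k - 1)"
    proof (rule ccontr)
      assume "\<not> c < xs ! (k - 1)"
      then have "\<not> xs ! i > c" if "k - 1 \<le> i" "i < length xs" for i
        using mono[OF that] by simp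
      then have "{i. i < length xs \<and> xs ! i > c} \<subseteq> {..<k - 1}"
        by (auto simp: not_le[symmetric])
      then show False
        using k card_mono[of "{..<k - 1}" "{i. i < length xs \<and> xs ! i > c}"] assms by simp
    qed
  qed
  ultimately show ?thesis
    by (simp add: kth_largest_root_def xs_def[symmetric] ra)
qed

text \<open>
  A point separating \<open>\<lambda>\<^sub>k h\<close> from both \<open>\<lambda>\<^sub>k f\<close> and \<open>\<lambda>\<^sub>k g\<close> would contradict the previous count: the
  value of \<open>h\<close> there has the sign of the value of \<open>f\<close> or of \<open>g\<close>.
\<close>
lemma kth_largest_root_convex_combination:
  fixes f g :: "real poly"
  assumes stable: "\<And>t. 0 \<le> t \<Longrightarrow> t \<le> 1 \<Longrightarrow> upper_stable (smult (1 - t) f + smult t g)"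
    and monic: "lead_coeff f = 1" "lead_coeff g = 1" "degree f = degree g"
    and k: "1 \<le> k" "k \<le> degree f"
    and \<alpha>: "0 \<le> \<alpha>" "\<alpha> \<le> 1"
  defines "h \<equiv> smult (1 - \<alpha>) f + smult \<alpha> g"
  shows "kth_largest_root k f \<le> kth_largest_root k h \<or> kth_largest_root k g \<le> kth_largest_root k h"
proof (rule ccontr)
  assume "\<not> ?thesis"
  then have less: "kth_largest_root k h < min (kth_largest_root k f) (kth_largest_root k g)"
    by auto
  have f: "upper_stable f" and g: "upper_stable g" and h: "upper_stable h"
    using stable[of 0] stable[of 1] stable[OF \<alpha>] by (auto simp: h_def)
  have c1: "coeff h (degree f) = 1"
    using monic by (simp add: h_def)
  moreover have "degree h \<le> degree f"
    unfolding h_def using monic(3) by (intro degree_add_le) (auto intro: order_trans[OF degree_smult_le])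
  ultimately have h': "degree h = degree f" "lead_coeff h = 1"
    using le_degree[of h "degree f"] by (metis antisym zero_neq_one)+
  \<comment> \<open>The interval is infinite and the three polynomials have finitely many roots, so
    a separating point can be chosen where all values are nonzero.\<close>
  let ?Z = "{x. poly (f * g * h) x = 0}"
  have "finite ?Z"
    using f g h by (intro poly_roots_finite) (auto simp: upper_stable_not_0)
  moreover have "infinite {kth_largest_root k h<..<min (kth_largest_root k f) (kth_largest_root k g)}"
    using less by (rule infinite_Ioo)
  ultimately have "{kth_largest_root k h<..<min (kth_largest_root k f) (kth_largest_root k g)} - ?Z \<noteq> {}"
    by (metis Diff_infinite_finite finite.emptyI)
  then obtain c where "c \<in> {kth_largest_root k h<..<min (kth_largest_root k f) (kth_largest_root k g)} - ?Z"
    by blast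
  then have c: "kth_largest_root k h < c" "c < kth_largest_root k f" "c < kth_largest_root k g"
    and nz: "poly f c \<noteq> 0" "poly g c \<noteq> 0" "poly h c \<noteq> 0"
    by auto
  have N: "k \<le> roots_above f c" "k \<le> roots_above g c" "\<not> k \<le> roots_above h c"
    using c k kth_largest_root_less_iff[of k f c] kth_largest_root_less_iff[of k g c]
      kth_largest_root_less_iff[of k h c] monic(3) h'
      upper_stable_size_proots[OF f] upper_stable_size_proots[OF g] upper_stable_size_proots[OF h]
    by auto
  have hc: "poly h c = (1 - \<alpha>) * poly f c + \<alpha> * poly g c"
    by (simp add: h_def)
  have "poly h c * poly h c = (1 - \<alpha>) * (poly f c * poly h c) + \<alpha> * (poly g c * poly h c)"
    by (subst (1) hc) (simp add: algebra_simps)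
  moreover have "poly h c * poly h c > 0"
    using nz by (auto simp: zero_less_mult_iff)
  moreover have "(1 - \<alpha>) * x + \<alpha> * y \<le> 0" if "x \<le> 0" "y \<le> 0" for x y
    using that \<alpha> by (intro add_nonpos_nonpos mult_nonneg_nonpos) auto
  ultimately have "poly f c * poly h c > 0 \<or> poly g c * poly h c > 0"
    by (auto simp: not_le[symmetric])
  then show False
  proof
    assume pos: "poly f c * poly h c > 0"
    \<comment> \<open>The segment from \<open>f\<close> to \<open>h\<close> is the initial part, up
      to parameter \<open>\<alpha>\<close>, of the stable segment from \<open>f\<close> to
      \<open>g\<close>.\<close>
    have "upper_stable (smult (1 - t) f + smult t h)" if "0 \<le> t" "t \<le> 1" for t
    proof -
      have "smult (1 - t) f + smult t h = smult (1 - t * \<alpha>) f + smult (t * \<alpha>) g"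
        by (rule poly_eqI) (simp add: h_def algebra_simps)
      then show ?thesis
        using stable[of "t * \<alpha>"] that \<alpha> by (simp add: mult_le_one)
    qed
    from roots_above_homotopy[OF this monic(1) h'(2) h'(1)[symmetric] pos] show False
      using N by simp
  next
    assume pos: "poly g c * poly h c > 0"
    have "upper_stable (smult (1 - t) g + smult t h)" if "0 \<le> t" "t \<le> 1" for t
    proof -
      have "smult (1 - t) g + smult t h = smult (1 - (1 - t + t * \<alpha>)) f + smult (1 - t + t * \<alpha>) g"
        by (rule poly_eqI) (simp add: h_def algebra_simps)
      then show ?thesis
        using stable[of "1 - t + t * \<alpha>"] that \<alpha>  mult_left_le[of \<alpha> t] by simp
    qed
    from roots_above_homotopy[OF this monic(2) h'(2) trans[OF monic(3)[symmetric] h'(1)[symmetric]] pos] show False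
      using N by simp
  qed
qed

subsection \<open>Pencils of stable polynomials\<close>

text \<open>
  The quotient \<open>r / q\<close> is never real and nonzero on the upper half plane, which stays connected without
  the roots of \<open>r\<close>; so its imaginary part has the sign it has near \<open>i \<infinity>\<close>.
\<close>
lemma upper_stable_pencil_sign:
  fixes q r :: "real poly"
  assumes stable: "\<And>t. upper_stable (q + smult t r)"
    and q: "lead_coeff q = 1" "degree q = Suc n"
    and r: "degree r \<le> n" "coeff r n < 0"
    and z: "Im z > 0"
  defines "c \<equiv> \<lambda>z. poly (map_poly complex_of_real r) z / poly (map_poly complex_of_real q) z"
  shows "c z = 0 \<or> Im (c z) > 0"
proof -
  let ?R = "map_poly complex_of_real r" and ?Q = "map_poly complex_of_real q"
  have Q0: "poly ?Q z \<noteq> 0" if "Im z > 0" for z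
    using stable[of 0] that by (auto simp: upper_stable_def)
  have nonreal: "c z = 0" if "Im z > 0" "Im (c z) = 0" for z
  proof (rule ccontr)
    assume "c z \<noteq> 0"
    define x where "x = Re (c z)"
    have x: "c z = of_real x"
      using that by (simp add: x_def complex_eq_iff)
    then have "x \<noteq> 0" using \<open>c z \<noteq> 0\<close> by auto
    have "poly ?R z = of_real x * poly ?Q z"
      using x Q0[OF that(1)] by (simp add: c_def field_simps)
    \<comment> \<open>A real nonzero quotient \<open>x\<close> makes the pencil member with
      parameter \<open>- 1 / x\<close> vanish at \<open>z\<close>.\<close>
    then have "poly (map_poly complex_of_real (q + smult (- 1 / x) r)) z = 0"
      using \<open>x \<noteq> 0\<close> by (simp add: map_poly_of_real)
    then show False
      using stable[of "- 1 / x"] that(1) by (auto simp: upper_stable_def)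
  qed
  have deg: "degree r = n" using r by (metis le_antisym le_degree less_irrefl)
  then have r0: "r \<noteq> 0" using r by auto
  \<comment> \<open>\<open>p\<close> represents \<open>z * r z\<close>, which has the degree of
    \<open>q\<close>; hence \<open>z * c z\<close> tends to the quotient of the leading
    coefficients, which is \<open>coeff r n\<close>.\<close>
  define p where "p = pCons 0 ?R"
  have R0: "?R \<noteq> 0" using r0 by (simp add: map_poly_eq_0_iff)
  have degR: "degree ?R = n" and degQ: "degree ?Q = Suc n"
    using deg q(2) by (simp_all add: degree_map_poly)
  have p: "degree p = Suc n" "coeff p (Suc n) = of_real (coeff r n)"
    using R0 degR by (simp_all add: p_def coeff_map_poly)
  have lim: "((\<lambda>z. z * c z) \<longlongrightarrow> of_real (coeff r n)) at_infinity"
  proof -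
    have "((\<lambda>z. (poly p z / z ^ Suc n) / (poly ?Q z / z ^ Suc n)) \<longlongrightarrow> of_real (coeff r n) / 1) at_infinity"
      using poly_divide_tendsto_aux[of p] poly_divide_tendsto_aux[of ?Q] q(1) unfolding p degQ
      by (intro tendsto_divide) (simp_all add: coeff_map_poly q(2))
    moreover have "eventually (\<lambda>z. (poly p z / z ^ Suc n) / (poly ?Q z / z ^ Suc n) = z * c z) at_infinity"
      unfolding eventually_at_infinity by (intro exI[of _ 1]) (auto simp: p_def c_def)
    ultimately show ?thesis
      using Lim_transform_eventually by force
  qed
  have "filterlim (\<lambda>y. Complex 0 y) at_infinity at_top"
    by (rule filterlim_at_infinity_conv_norm_at_top[THEN iffD2])
       (auto simp: cmod_def filterlim_abs_real)
  from filterlim_compose[OF lim this]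
  have "eventually (\<lambda>y. dist (Complex 0 y * c (Complex 0 y)) (of_real (coeff r n)) < - coeff r n) at_top"
    using r(2) by (intro tendstoD) auto
  moreover have "eventually (\<lambda>y::real. y > 0) at_top" by (rule eventually_gt_at_top)
  ultimately have "eventually (\<lambda>y. y > 0 \<and> dist (Complex 0 y * c (Complex 0 y)) (of_real (coeff r n)) < - coeff r n) at_top"
    by eventually_elim auto
  then obtain y where y: "y > 0" "dist (Complex 0 y * c (Complex 0 y)) (of_real (coeff r n)) < - coeff r n"
    by (metis (no_types, lifting) eventually_at_top_linorder order_refl)
  define z0 where "z0 = Complex 0 y"
  have "\<bar>Re (z0 * c z0) - coeff r n\<bar> \<le> dist (z0 * c z0) (of_real (coeff r n))"
    using abs_Re_le_cmod[of "z0 * c z0 - of_real (coeff r n)"] by (simp add: dist_norm)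
  then have "Re (z0 * c z0) < 0" using y(2) unfolding z0_def by linarith
  \<comment> \<open>At \<open>z0 = i y\<close> one has
    \<open>Re (z0 * c z0) = - y * Im (c z0)\<close>.\<close>
  then have pos: "Im (c z0) > 0"
    using y(1) by (simp add: z0_def zero_less_mult_iff)
  then have z0: "Im z0 > 0" "poly ?R z0 \<noteq> 0"
    using y(1) by (auto simp: z0_def c_def)
  define U where "U = {z. Im z > 0} - {z. poly ?R z = 0}"
  have "connected U"
    unfolding U_def
  proof (rule connected_open_delete_finite)
    show "open {z. Im z > 0}" by (rule open_halfspace_Im_gt)
    show "connected {z. Im z > 0}" by (intro convex_connected convex_halfspace_Im_gt)
    show "finite {z. poly ?R z = 0}" using R0 by (rule poly_roots_finite)
  qed auto
  moreover have "continuous_on U (\<lambda>z. Im (c z))"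
    unfolding c_def U_def using Q0 by (intro continuous_intros) auto
  ultimately have "connected ((\<lambda>z. Im (c z)) ` U)" by (rule connected_continuous_image[rotated])
  moreover have "0 \<notin> (\<lambda>z. Im (c z)) ` U"
    using nonreal Q0 by (auto simp: U_def c_def)
  ultimately have "Im (c z) > 0" if "z \<in> U" for z
    using that z0 pos connectedD_interval[of "(\<lambda>z. Im (c z)) ` U" "Im (c z)" "Im (c z0)" 0]
    by (force simp: U_def)
  then show ?thesis
    using z by (cases "poly ?R z = 0") (auto simp: U_def c_def)
qed

subsection \<open>Rank-one perturbations of the characteristic polynomial\<close>

definition outer :: "real^'n \<Rightarrow> real^'n^'n" where
  "outer w = (\<chi> i j. w $ i * w $ j)"

lemma outer_0 [simp]: "outer 0 = 0"
  by (simp add: outer_def vec_eq_iff)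

lemma transpose_outer [simp]: "transpose (outer w) = outer w"
  by (simp add: outer_def transpose_def vec_eq_iff mult.commute)

lemma transpose_add: "transpose (A + B) = transpose A + transpose B"
  by (simp add: transpose_def vec_eq_iff)

lemma transpose_diff: "transpose (A - B) = transpose A - transpose B"
  by (simp add: transpose_def vec_eq_iff)

lemma transpose_scaleR: "transpose (t *\<^sub>R A) = t *\<^sub>R transpose A"
  by (simp add: transpose_def vec_eq_iff)

lemma conjugate_outer: "Q ** outer w ** transpose Q = outer (Q *v w)"
  by (simp add: outer_def vec_eq_iff matrix_matrix_mult_def matrix_vector_mult_def transpose_def
      sum_distrib_left sum_distrib_right mult_ac)

lemma conjugate_add_scaleR:
  fixes Q :: "real^'n^'n"
  shows "Q ** (A + t *\<^sub>R B) ** transpose Q = Q ** A ** transpose Q + t *\<^sub>R (Q ** B ** transpose Q)"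
  by (simp add: vec_eq_iff matrix_matrix_mult_def transpose_def sum_distrib_left sum_distrib_right
      sum.distrib algebra_simps)

lemma transpose_conjugate:
  fixes Q :: "real^'n^'n"
  assumes "transpose A = A"
  shows "transpose (Q ** A ** transpose Q) = Q ** A ** transpose Q"
  using assms by (simp add: matrix_transpose_mul matrix_mul_assoc)

text \<open>Only row \<open>k\<close> of the matrix changes, and the determinant is affine in a
  single row.\<close>

lemma det_add_outer_axis:
  fixes M :: "real^'n^'n"
  shows "det (M + t *\<^sub>R outer (axis k c)) = det M + t * (c\<^sup>2 * det (\<chi> i. if i = k then axis k 1 else M $ i))"
proof -
  have "M + t *\<^sub>R outer (axis k c) = (\<chi> i. if i = k then M $ i + (t * c\<^sup>2) *s axis k 1 else M $ i)"
    by (auto simp: vec_eq_iff outer_def axis_def power2_eq_square)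
  also have "det \<dots> = det (\<chi> i. if i = k then M $ i else M $ i)
      + det (\<chi> i. if i = k then (t * c\<^sup>2) *s axis k 1 else M $ i)"
    by (rule det_row_add)
  also have "det (\<chi> i. if i = k then (t * c\<^sup>2) *s axis k 1 else M $ i)
      = (t * c\<^sup>2) * det (\<chi> i. if i = k then axis k 1 else M $ i)"
    by (rule det_row_mul)
  finally show ?thesis by simp
qed

text \<open>An orthogonal change of basis takes \<open>w\<close> to a multiple of a basis vector and
  preserves determinants, which reduces affinity in \<open>t\<close> to the axis case. The slope is
  read off at \<open>t = 1\<close>.\<close>

lemma det_add_outer:
  fixes M :: "real^'n^'n"
  shows "det (M + t *\<^sub>R outer w) = det M + t * (det (M + outer w) - det M)"
proof -
  fix k :: 'n
  have "norm w = norm (axis k (norm w))" by (simp add: norm_eq_sqrt_inner inner_axis_axis)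
  then obtain f where f: "orthogonal_transformation f" "f w = axis k (norm w)"
    by (rule orthogonal_transformation_exists)
  define Q where "Q = matrix f"
  have Q: "orthogonal_matrix Q" "Q *v w = axis k (norm w)"
    using f orthogonal_transformation_matrix[of f] by (simp_all add: Q_def matrix_works)
  have det: "det (Q ** X ** transpose Q) = det X" for X
    using det_orthogonal_matrix[OF Q(1)] by (auto simp: det_mul)
  have "det (M + t *\<^sub>R outer w)
      = det (Q ** M ** transpose Q + t *\<^sub>R outer (axis k (norm w)))" for t
    by (metis det conjugate_add_scaleR conjugate_outer Q(2))
  then have "det (M + t *\<^sub>R outer w)
     = det M + t * ((norm w)\<^sup>2 * det (\<chi> i. if i = k then axis k 1 else (Q ** M ** transpose Q) $ i))" for t
    by (simp add: det_add_outer_axis det)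
  from this[of t] this[of 1] show ?thesis by simp
qed

lemma coeff_prod_linear:
  fixes a :: "'i \<Rightarrow> real"
  assumes "finite S"
  shows "degree (\<Prod>i\<in>S. [:- a i, 1:]) = card S"
    and "coeff (\<Prod>i\<in>S. [:- a i, 1:]) (card S) = 1"
    and "card S = Suc n \<Longrightarrow> coeff (\<Prod>i\<in>S. [:- a i, 1:]) n = - (\<Sum>i\<in>S. a i)"
  using assms
proof (induction S arbitrary: n rule: finite_induct)
  case (insert x S)
  let ?P = "\<Prod>i\<in>S. [:- a i, 1:]"
  have e: "(\<Prod>i\<in>insert x S. [:- a i, 1:]) = [:- a x, 1:] * ?P"
    using insert.hyps by (rule prod.insert)
  have P0: "?P \<noteq> 0" using insert.hyps by auto
  {
    case 1
    show ?case unfolding e using P0 insert by (subst degree_mult_eq) auto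
  next
    case 2
    have "coeff ?P (Suc (card S)) = 0"
      using insert.IH(1) by (intro coeff_eq_0) simp
    then show ?case unfolding e using insert by (simp del: prod.insert)
  next
    case 3
    then have n: "n = card S" using insert.hyps by simp
    show ?case
    proof (cases n)
      case 0
      then show ?thesis using n insert.hyps by simp
    next
      case (Suc l)
      then have "card S = Suc l" using n by simp
      with insert.IH(3)[OF this] insert.IH(2) insert.hyps n show ?thesis
        unfolding e by simp
    qed
  }
qed simp_all

lemma coeff_charpoly:
  fixes A :: "real^'n^'n"
  shows "coeff (charpoly A) CARD('n) = 1"
    and "coeff (charpoly A) (CARD('n) - 1) = - trace A"
proof -
  define X where "X = mat [:0, 1:] - map_matrix (\<lambda>a. [:a:]) A"
  let ?P = "{p. p permutes (UNIV :: 'n set)}"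
  have X: "X $ i $ j = (if i = j then [:- A $ i $ i, 1:] else [:- A $ i $ j:])" for i j
    by (simp add: X_def mat_def)
  \<comment> \<open>A permutation other than the identity moves at least two points, and
    off-diagonal entries are constant. Its product has degree at most \<open>CARD('n') - 2\<close>,
    so the top two coefficients come from the diagonal alone.\<close>
  have other: "coeff (of_int (sign p) * (\<Prod>i\<in>UNIV. X $ i $ p i)) k = 0"
    if p: "p permutes UNIV" "p \<noteq> id" and k: "k \<ge> CARD('n) - 1" for p k
  proof -
    obtain i where i: "p i \<noteq> i" using p(2) by (auto simp: fun_eq_iff)
    have inj: "inj p" using p(1) by (rule permutes_inj)
    have "p (p i) \<noteq> p i" using i inj by (auto dest: injD)
    then have sub: "{i, p i} \<subseteq> {j. p j \<noteq> j}" using i by auto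
    have c: "2 \<le> card {j. p j \<noteq> j}"
      using card_mono[OF _ sub] i by (simp add: eq_commute)
    have "degree (\<Prod>i\<in>UNIV. X $ i $ p i) \<le> sum (degree \<circ> (\<lambda>i. X $ i $ p i)) UNIV"
      by (rule degree_prod_sum_le) simp
    also have "\<dots> = (\<Sum>i\<in>UNIV. if p i = i then 1 else 0)"
      by (intro sum.cong) (auto simp: X)
    also have "\<dots> = card {i. p i = i}"
      by (simp add: sum.If_cases)
    also have "{i. p i = i} = UNIV - {j. p j \<noteq> j}" by auto
    also have "card \<dots> = CARD('n) - card {j. p j \<noteq> j}"
      by (intro card_Diff_subset) auto
    finally have "degree (\<Prod>i\<in>UNIV. X $ i $ p i) \<le> CARD('n) - card {j. p j \<noteq> j}" .
    moreover have "card {j. p j \<noteq> j} \<le> CARD('n)" by (intro card_mono) auto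
    ultimately have "degree (\<Prod>i\<in>UNIV. X $ i $ p i) < k" using c k by linarith
    then show ?thesis by (simp add: of_int_poly coeff_eq_0)
  qed
  have "coeff (charpoly A) k = coeff (\<Prod>i\<in>UNIV. [:- A $ i $ i, 1:]) k" if "k \<ge> CARD('n) - 1" for k
  proof -
    have "coeff (charpoly A) k = (\<Sum>p\<in>?P. coeff (of_int (sign p) * (\<Prod>i\<in>UNIV. X $ i $ p i)) k)"
      by (simp add: charpoly_def det_def X_def coeff_sum)
    also have "\<dots> = coeff (of_int (sign id) * (\<Prod>i\<in>UNIV. X $ i $ id i)) k"
      using other that
      by (subst sum.remove[of _ id]) (auto simp: permutes_id intro!: sum.neutral)
    finally show ?thesis by (simp add: X)
  qed
  note * = this
  show "coeff (charpoly A) CARD('n) = 1"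
    using *[of "CARD('n)"] coeff_prod_linear(2)[of "UNIV :: 'n set" "\<lambda>i. A $ i $ i"] by simp
  show "coeff (charpoly A) (CARD('n) - 1) = - trace A"
    using *[of "CARD('n) - 1"] coeff_prod_linear(3)[of "UNIV :: 'n set" "CARD('n) - 1" "\<lambda>i. A $ i $ i"]
    by (simp add: trace_def)
qed

lemma degree_charpoly: "degree (charpoly (A :: real^'n^'n)) = CARD('n)"
  using coeff_charpoly(1)[of A] degree_charpoly_le[of A] by (intro antisym le_degree) auto

text \<open>The determinant is affine along a rank-one direction. Leading terms cancel because both
  polynomials are monic, and the next coefficient of \<open>r\<close> is minus the increase of the
  trace, \<open>- (w \<bullet> w)\<close>.\<close>

lemma charpoly_add_outer:
  fixes A :: "real^'n^'n"
  assumes "w \<noteq> 0"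
  shows "\<exists>r. degree r \<le> CARD('n) - 1 \<and> coeff r (CARD('n) - 1) < 0 \<and>
    (\<forall>t. charpoly (A + t *\<^sub>R outer w) = charpoly A + smult t r)"
proof (intro exI conjI allI)
  define r where "r = charpoly (A + outer w) - charpoly A"
  have "degree r \<le> CARD('n)"
    unfolding r_def by (intro degree_diff_le) (simp_all add: degree_charpoly)
  moreover have "coeff r CARD('n) = 0"
    by (simp add: r_def coeff_charpoly)
  ultimately show "degree r \<le> CARD('n) - 1"
    by (metis One_nat_def Suc_pred degree_0 leading_coeff_0_iff le_less less_Suc_eq_le zero_less_card_finite zero_le)
  have "trace (outer w) = w \<bullet> w"
    by (simp add: trace_def outer_def inner_vec_def)
  then show "coeff r (CARD('n) - 1) < 0"
    using assms by (simp add: r_def coeff_charpoly trace_add del: One_nat_def)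
  show "charpoly (A + t *\<^sub>R outer w) = charpoly A + smult t r" for t
  proof -
    have "poly (charpoly (A + t *\<^sub>R outer w)) x = poly (charpoly A + smult t r) x" for x
    proof -
      have "mat x - (A + t *\<^sub>R outer w) = (mat x - A) + (- t) *\<^sub>R outer w"
        "mat x - (A + outer w) = (mat x - A) + (- 1) *\<^sub>R outer w"
        by simp_all
      \<comment> \<open>\<open>r\<close> subtracts \<open>outer w\<close> from
        \<open>mat x - A\<close>, while \<open>det_add_outer\<close> measures the slope by adding
        it; affinity makes the two increments opposite.\<close>
      moreover have "det (mat x - A + outer w) - det (mat x - A)
          = - (det ((mat x - A) + (- 1) *\<^sub>R outer w) - det (mat x - A))"
      proof -
        have "b - a = - (e - a)" if "e = a + - 1 * (b - a)" for a b e :: real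
          using that by simp
        then show ?thesis using det_add_outer[of "mat x - A" "- 1" w] .
      qed
      ultimately show ?thesis
        unfolding r_def poly_add poly_smult poly_diff poly_charpoly
        using det_add_outer[of "mat x - A" "- t" w] by (simp only: minus_mult_minus)
    qed
    then show ?thesis by (intro poly_eq_poly_eq_iff[THEN iffD1] ext)
  qed
qed

text \<open>A root \<open>z\<close> yields a complex vector \<open>v \<noteq> 0\<close> with
  \<open>A v = z v\<close>. As \<open>A\<close> is real symmetric, its Hermitian form at
  \<open>v\<close> is real, and it equals \<open>z\<close> times the squared norm of
  \<open>v\<close>, forcing \<open>Im z = 0\<close>.\<close>

lemma upper_stable_charpoly:
  fixes A :: "real^'n^'n"
  assumes sym: "transpose A = A"
  shows "upper_stable (charpoly A)"
  unfolding upper_stable_def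
proof (intro allI impI notI)
  fix z assume z: "Im z > 0" and root: "poly (map_poly complex_of_real (charpoly A)) z = 0"
  define N :: "complex^'n^'n" where "N = mat z - map_matrix complex_of_real A"
  have sum: "map_poly complex_of_real (sum f S) = (\<Sum>x\<in>S. map_poly complex_of_real (f x))"
    for f and S :: "('n \<Rightarrow> 'n) set"
    by (induction S rule: infinite_finite_induct) (simp_all add: map_poly_of_real)
  have prod: "map_poly complex_of_real (prod f S) = (\<Prod>x\<in>S. map_poly complex_of_real (f x))"
    for f and S :: "'n set"
    by (induction S rule: infinite_finite_induct) (simp_all add: map_poly_of_real)
  have "poly (map_poly complex_of_real (charpoly A)) z = det N"
    unfolding charpoly_def det_def N_def
    by (simp add: sum prod map_poly_of_real of_int_poly map_poly_pCons poly_sum poly_prod mat_def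
        if_distrib[of "\<lambda>p. poly (map_poly complex_of_real p) z"] cong: if_cong)
  then have "\<not> invertible N" using root by (simp add: invertible_det_nz)
  then obtain v where v: "N *v v = 0" "v \<noteq> 0"
    using matrix_left_invertible_ker[of N] invertible_left_inverse[of N] by auto
  have Nv: "z * v $ i = (\<Sum>j\<in>UNIV. of_real (A $ i $ j) * v $ j)" for i
  proof -
    have "(\<Sum>j\<in>UNIV. (if i = j then z else 0) * v $ j) = z * v $ i"
      by (simp add: if_distrib[of "\<lambda>x. x * _"] cong: if_cong)
    moreover have "(N *v v) $ i = 0" using v by simp
    ultimately show ?thesis
      by (simp add: matrix_vector_mult_def N_def mat_def left_diff_distrib sum_subtractf)
  qed
  define s where "s = (\<Sum>i\<in>UNIV. \<Sum>j\<in>UNIV. of_real (A $ i $ j) * (cnj (v $ i) * v $ j))"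
  have "A $ i $ j = A $ j $ i" for i j
    using sym by (metis transpose_def vec_lambda_beta)
  then have "cnj s = (\<Sum>i\<in>UNIV. \<Sum>j\<in>UNIV. of_real (A $ j $ i) * (cnj (v $ j) * v $ i))"
    by (simp add: s_def mult_ac)
  also have "\<dots> = s" unfolding s_def by (rule sum.swap)
  finally have "Im s = 0" by (metis Reals_cnj_iff complex_is_Real_iff)
  have "of_real (\<Sum>i\<in>UNIV. (cmod (v $ i))\<^sup>2) * z = (\<Sum>i\<in>UNIV. cnj (v $ i) * (z * v $ i))"
    unfolding of_real_sum sum_distrib_right by (intro sum.cong) (simp_all only: complex_norm_square mult_ac)
  also have "\<dots> = s"
    unfolding Nv s_def by (simp add: sum_distrib_left mult_ac)
  finally have "(\<Sum>i\<in>UNIV. (cmod (v $ i))\<^sup>2) * Im z = 0"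
    using \<open>Im s = 0\<close> by (metis Im_complex_of_real Re_complex_of_real add.right_neutral mult_zero_left times_complex.sel(2))
  then have "(\<Sum>i\<in>UNIV. (cmod (v $ i))\<^sup>2) = 0" using z by simp
  then have "v = 0" by (subst (asm) sum_nonneg_eq_0_iff) (auto simp: vec_eq_iff)
  then show False using v by simp
qed

subsection \<open>Determinant-like polynomials and random swaps\<close>

definition symmetric_tuple :: "(nat \<Rightarrow> real^'n^'n) \<Rightarrow> bool" where
  "symmetric_tuple A \<longleftrightarrow> (\<forall>i. transpose (A i) = A i)"

text \<open>Affinity in \<open>t\<close> and the strict sign are traits of the characteristic
  polynomial that survive convex combinations. The sign decides on which side of the real axis
  \<open>r / p\<close> lies high on the imaginary axis.\<close>

definition determinant_like :: "nat set \<Rightarrow> ((nat \<Rightarrow> real^'n^'n) \<Rightarrow> real poly) \<Rightarrow> bool" where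
  "determinant_like I p \<longleftrightarrow> (\<forall>A. symmetric_tuple A \<longrightarrow>
     upper_stable (p A) \<and> degree (p A) = CARD('n) \<and> lead_coeff (p A) = 1 \<and>
     (\<forall>i\<in>I. \<forall>w. w \<noteq> 0 \<longrightarrow>
        (\<exists>r. degree r \<le> CARD('n) - 1 \<and> coeff r (CARD('n) - 1) < 0 \<and>
           (\<forall>t. p (A(i := A i + t *\<^sub>R outer w)) = p A + smult t r))))"

lemma determinant_like_charpoly_sum:
  "determinant_like {1..m} (\<lambda>A. charpoly (\<Sum>i=1..m. A i :: real^'n^'n))"
  unfolding determinant_like_def
proof (intro allI impI conjI ballI)
  fix A :: "nat \<Rightarrow> real^'n^'n" assume A: "symmetric_tuple A"
  let ?S = "\<Sum>i=1..m. A i"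
  have "transpose (\<Sum>i\<in>J. A i) = (\<Sum>i\<in>J. A i)" for J
    using A by (induction J rule: infinite_finite_induct)
      (auto simp: transpose_add symmetric_tuple_def transpose_def vec_eq_iff)
  then show "upper_stable (charpoly ?S)" by (rule upper_stable_charpoly)
  show "degree (charpoly ?S) = CARD('n)" by (rule degree_charpoly)
  then show "lead_coeff (charpoly ?S) = 1" by (simp add: coeff_charpoly)
  fix i and w :: "real^'n" assume i: "i \<in> {1..m}" and w: "w \<noteq> 0"
  have "(\<Sum>j=1..m. (A(i := A i + t *\<^sub>R outer w)) j) = ?S + t *\<^sub>R outer w" for t
  proof -
    have "(\<Sum>j=1..m. (A(i := A i + t *\<^sub>R outer w)) j) = (\<Sum>j=1..m. A j + (if j = i then t *\<^sub>R outer w else 0))"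
      by (intro sum.cong) auto
    then show ?thesis using i by (simp add: sum.distrib)
  qed
  then show "\<exists>r. degree r \<le> CARD('n) - 1 \<and> coeff r (CARD('n) - 1) < 0 \<and>
      (\<forall>t. charpoly (\<Sum>j=1..m. (A(i := A i + t *\<^sub>R outer w)) j) = charpoly ?S + smult t r)"
    using charpoly_add_outer[OF w, of ?S] by simp
qed

lemma perm_matrix_transpose_conjugate:
  "(perm_matrix (Transposition.transpose s t) ** X ** transpose (perm_matrix (Transposition.transpose s t))) $ a $ b
    = X $ Transposition.transpose s t a $ Transposition.transpose s t b"
proof -
  have e: "a = Transposition.transpose s t k \<longleftrightarrow> k = Transposition.transpose s t a" for a k
    by auto
  show ?thesis
    by (simp add: matrix_matrix_mult_def perm_matrix_def transpose_def e if_distrib[of "\<lambda>x. x * _"]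
        if_distrib[of "\<lambda>x. _ * x"] cong: if_cong)
qed

text \<open>
  With \<open>f = e\<^sub>s - e\<^sub>t\<close> the swap is the reflection \<open>T = I - f f\<^sup>T\<close>, so that
  \<open>A - T A T = f g\<^sup>T + g f\<^sup>T\<close> for \<open>g = A f - (f \<bullet> A f / 2) f\<close>; polarization turns this into
  a difference of two rank-one matrices.
\<close>
lemma swap_conjugate_rank_one:
  fixes A :: "real^'n^'n"
  assumes "s \<noteq> t" "transpose A = A"
  defines "T \<equiv> perm_matrix (Transposition.transpose s t)"
  shows "\<exists>u v. A - outer u = T ** A ** transpose T - outer v"
proof -
  define f :: "real^'n" where "f = axis s 1 - axis t 1"
  define g where "g = A *v f - ((A $ s $ s - 2 * A $ s $ t + A $ t $ t) / 2) *\<^sub>R f"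
  have sym: "A $ i $ j = A $ j $ i" for i j
    using assms(2) by (metis transpose_def vec_lambda_beta)
  have f: "f $ i = (if i = s then 1 else if i = t then -1 else 0)" for i
    using assms(1) by (auto simp: f_def axis_def)
  have Af: "(A *v f) $ i = A $ i $ s - A $ i $ t" for i
    by (simp add: f_def matrix_vector_mult_diff_distrib matrix_vector_mult_basis column_def)
  have g: "g $ i = A $ i $ s - A $ i $ t - ((A $ s $ s - 2 * A $ s $ t + A $ t $ t) / 2) * f $ i" for i
    by (simp add: g_def Af)
  have "(A - T ** A ** transpose T) $ i $ j = f $ i * g $ j + g $ i * f $ j" for i j
    unfolding T_def vector_minus_component perm_matrix_transpose_conjugate f g
    using assms(1) sym[of t s] sym[of i s] sym[of i t] sym[of j s] sym[of j t]
    by (auto simp: Transposition.transpose_def field_simps)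
  then have D: "A $ i $ j - (T ** A ** transpose T) $ i $ j = f $ i * g $ j + g $ i * f $ j" for i j
    by simp
  define u where "u = (1 / sqrt 2) *\<^sub>R (f + g)"
  define v where "v = (1 / sqrt 2) *\<^sub>R (f - g)"
  have "outer u $ i $ j - outer v $ i $ j = f $ i * g $ j + g $ i * f $ j" for i j
    by (simp add: outer_def u_def v_def field_simps)
  with D have "A - outer u = T ** A ** transpose T - outer v"
    by (simp add: vec_eq_iff algebra_simps)
  then show ?thesis by blast
qed

text \<open>The averaging acts on the functional \<open>p\<close> instead of on the law of the
  matrices, so that a swap can be absorbed into \<open>p\<close>.\<close>

definition swap_average ::
  "nat \<Rightarrow> 'n \<Rightarrow> 'n \<Rightarrow> real \<Rightarrow> ((nat \<Rightarrow> real^'n^'n) \<Rightarrow> real poly) \<Rightarrow> (nat \<Rightarrow> real^'n^'n) \<Rightarrow> real poly" where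
  "swap_average i s t \<alpha> p A = smult (1 - \<alpha>) (p A) + smult \<alpha> (p (A(i :=
     perm_matrix (Transposition.transpose s t) ** A i ** transpose (perm_matrix (Transposition.transpose s t)))))"

lemma symmetric_tuple_upd:
  "symmetric_tuple A \<Longrightarrow> transpose X = X \<Longrightarrow> symmetric_tuple (A(i := X))"
  by (simp add: symmetric_tuple_def)

lemma symmetric_tuple_upd_conjugate:
  "symmetric_tuple A \<Longrightarrow> symmetric_tuple (A(i := Q ** A i ** transpose Q))"
  by (simp add: symmetric_tuple_def transpose_conjugate)

text \<open>The pencil lemma enters with \<open>t = 1\<close>. The case \<open>w = 0\<close>,
  outside the definition, is covered by \<open>r = 0\<close>, so the vectors of the rank-one
  decomposition need not be shown to be nonzero.\<close>

lemma determinant_like_rank_one_sign: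
  fixes p :: "(nat \<Rightarrow> real^'n^'n) \<Rightarrow> real poly"
  assumes p: "determinant_like I p" and A: "symmetric_tuple A" and i: "i \<in> I"
  shows "\<exists>r. p (A(i := A i + outer w)) = p A + r \<and>
    (\<forall>z. Im z > 0 \<longrightarrow> (let c = poly (map_poly complex_of_real r) z / poly (map_poly complex_of_real (p A)) z
       in c = 0 \<or> Im c > 0))"
proof (cases "w = 0")
  case True
  then show ?thesis by (intro exI[of _ 0]) simp
next
  case False
  then obtain r where r: "degree r \<le> CARD('n) - 1" "coeff r (CARD('n) - 1) < 0"
      "\<And>t. p (A(i := A i + t *\<^sub>R outer w)) = p A + smult t r"
    using p A i unfolding determinant_like_def by blast
  have "upper_stable (p A + smult t r)" for t
  proof -
    have "symmetric_tuple (A(i := A i + t *\<^sub>R outer w))"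
      using A by (intro symmetric_tuple_upd) (auto simp: transpose_add transpose_scaleR symmetric_tuple_def)
    then show ?thesis
      using p r(3)[of t] unfolding determinant_like_def by metis
  qed
  moreover have "lead_coeff (p A) = 1" "degree (p A) = Suc (CARD('n) - 1)"
    using p A unfolding determinant_like_def by auto
  ultimately show ?thesis
    using upper_stable_pencil_sign[of "p A" r "CARD('n) - 1"] r(1,2) r(3)[of 1]
    by (intro exI[of _ r]) (simp add: Let_def)
qed

lemma upper_stable_swap_average:
  fixes p :: "(nat \<Rightarrow> real^'n^'n) \<Rightarrow> real poly"
  assumes p: "determinant_like I p" and A: "symmetric_tuple A" and i: "i \<in> I"
    and st: "s \<noteq> t" and \<alpha>: "0 \<le> \<alpha>" "\<alpha> \<le> 1"
  shows "upper_stable (swap_average i s t \<alpha> p A)"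
proof -
  define T where "T = perm_matrix (Transposition.transpose s t)"
  obtain u v where uv: "A i - outer u = T ** A i ** transpose T - outer v"
    using swap_conjugate_rank_one[OF st] A unfolding T_def symmetric_tuple_def by blast
  \<comment> \<open>Both \<open>A\<close> and its swapped version arise from this tuple by adding a
    rank-one matrix to entry \<open>i\<close>.\<close>
  define B where "B = A(i := A i - outer u)"
  have B: "symmetric_tuple B"
    using A unfolding B_def by (intro symmetric_tuple_upd) (auto simp: transpose_diff symmetric_tuple_def)
  have "B(i := B i + outer u) = A" by (auto simp: B_def)
  then obtain r where r: "p A = p B + r"
    "\<And>z. Im z > 0 \<Longrightarrow> (let c = poly (map_poly complex_of_real r) z / poly (map_poly complex_of_real (p B)) z
       in c = 0 \<or> Im c > 0)"
    using determinant_like_rank_one_sign[OF p B i, of u] by auto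
  have "B(i := B i + outer v) = A(i := T ** A i ** transpose T)" using uv by (auto simp: B_def)
  then obtain r' where r': "p (A(i := T ** A i ** transpose T)) = p B + r'"
    "\<And>z. Im z > 0 \<Longrightarrow> (let c = poly (map_poly complex_of_real r') z / poly (map_poly complex_of_real (p B)) z
       in c = 0 \<or> Im c > 0)"
    using determinant_like_rank_one_sign[OF p B i, of v] by auto
  show ?thesis
    unfolding upper_stable_def
  proof (intro allI impI notI)
    fix z assume z: "Im z > 0"
      and root: "poly (map_poly complex_of_real (swap_average i s t \<alpha> p A)) z = 0"
    define b where "b = poly (map_poly complex_of_real (p B)) z"
    have "b \<noteq> 0" using p B z by (auto simp: b_def determinant_like_def upper_stable_def)
    define c where "c = poly (map_poly complex_of_real r) z / b"
    define c' where "c' = poly (map_poly complex_of_real r') z / b"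
    have c: "c = 0 \<or> Im c > 0" "c' = 0 \<or> Im c' > 0"
      using r(2)[OF z] r'(2)[OF z] by (auto simp: c_def c'_def b_def Let_def)
    have "poly (map_poly complex_of_real (swap_average i s t \<alpha> p A)) z
       = b * (1 + (1 - of_real \<alpha>) * c + of_real \<alpha> * c')"
      using \<open>b \<noteq> 0\<close> unfolding swap_average_def T_def[symmetric] r(1) r'(1)
      by (simp add: map_poly_of_real b_def[symmetric] c_def c'_def field_simps)
    then have 0: "1 + (1 - of_real \<alpha>) * c + of_real \<alpha> * c' = 0"
      using root \<open>b \<noteq> 0\<close> by simp
    \<comment> \<open>Both summands are nonnegative, so both vanish. A quotient with positive
      imaginary part then has weight 0, and the equation collapses to 1 = 0.\<close>
    then have "(1 - \<alpha>) * Im c + \<alpha> * Im c' = 0"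
      by (simp add: complex_eq_iff)
    moreover have "(1 - \<alpha>) * Im c \<ge> 0" "\<alpha> * Im c' \<ge> 0"
      using c \<alpha> by auto
    ultimately have "(1 - \<alpha>) * Im c = 0" "\<alpha> * Im c' = 0" by linarith+
    then have "(1 - of_real \<alpha>) * c = 0" "of_real \<alpha> * c' = 0"
      using c by auto
    then show False using 0 by (metis add.right_neutral zero_neq_one)
  qed
qed

lemma perm_matrix_transpose_mult_nonzero:
  assumes "w \<noteq> 0"
  shows "perm_matrix (Transposition.transpose s t) *v w \<noteq> (0 :: real^'n)"
proof -
  have e: "a = Transposition.transpose s t k \<longleftrightarrow> k = Transposition.transpose s t a" for a k :: 'n
    by auto
  have "(perm_matrix (Transposition.transpose s t) *v w) $ a = w $ Transposition.transpose s t a" for a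
    by (simp add: matrix_vector_mult_def perm_matrix_def e if_distrib[of "\<lambda>x. x * _"] cong: if_cong)
  then show ?thesis
    using assms by (metis transpose_involutory vec_eq_iff zero_index)
qed

lemma determinant_like_swap_average:
  fixes p :: "(nat \<Rightarrow> real^'n^'n) \<Rightarrow> real poly"
  assumes p: "determinant_like I p" and i: "i \<in> I" and st: "s \<noteq> t" and \<alpha>: "0 \<le> \<alpha>" "\<alpha> \<le> 1"
  shows "determinant_like I (swap_average i s t \<alpha> p)"
  unfolding determinant_like_def
proof (intro allI impI)
  fix A :: "nat \<Rightarrow> real^'n^'n" assume A: "symmetric_tuple A"
  let ?q = "swap_average i s t \<alpha> p"
  define T where "T = perm_matrix (Transposition.transpose s t)"
  define A' where "A' = A(i := T ** A i ** transpose T)"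
  have A': "symmetric_tuple A'"
    unfolding A'_def using A by (rule symmetric_tuple_upd_conjugate)
  have q: "?q A = smult (1 - \<alpha>) (p A) + smult \<alpha> (p A')"
    by (simp add: swap_average_def A'_def T_def)
  have pA: "degree (p A) = CARD('n)" "lead_coeff (p A) = 1" "degree (p A') = CARD('n)" "lead_coeff (p A') = 1"
    using p A A' unfolding determinant_like_def by auto
  have "coeff (?q A) CARD('n) = 1" using pA by (simp add: q)
  moreover have "degree (?q A) \<le> CARD('n)"
    unfolding q using pA by (intro degree_add_le) (auto intro: order_trans[OF degree_smult_le])
  ultimately have deg: "degree (?q A) = CARD('n)" "lead_coeff (?q A) = 1"
    using le_degree[of "?q A" "CARD('n)"] by (metis antisym zero_neq_one)+
  have "\<exists>r. degree r \<le> CARD('n) - 1 \<and> coeff r (CARD('n) - 1) < 0 \<and>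
           (\<forall>x. ?q (A(j := A j + x *\<^sub>R outer w)) = ?q A + smult x r)"
    if j: "j \<in> I" and w: "w \<noteq> 0" for j w
  proof -
    \<comment> \<open>Conjugation by \<open>T\<close> sends \<open>outer w\<close> to
      \<open>outer (T *v w)\<close>, so at index \<open>i\<close> the swapped tuple is perturbed
      along \<open>T *v w\<close>.\<close>
    define w' where "w' = (if j = i then T *v w else w)"
    have "w' \<noteq> 0" using w by (simp add: w'_def T_def perm_matrix_transpose_mult_nonzero)
    obtain r where r: "degree r \<le> CARD('n) - 1" "coeff r (CARD('n) - 1) < 0"
      "\<And>x. p (A(j := A j + x *\<^sub>R outer w)) = p A + smult x r"
      using p A j w unfolding determinant_like_def by blast
    obtain r' where r': "degree r' \<le> CARD('n) - 1" "coeff r' (CARD('n) - 1) < 0"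
      "\<And>x. p (A'(j := A' j + x *\<^sub>R outer w')) = p A' + smult x r'"
      using p A' j \<open>w' \<noteq> 0\<close> unfolding determinant_like_def by blast
    have "?q (A(j := A j + x *\<^sub>R outer w)) = ?q A + smult x (smult (1 - \<alpha>) r + smult \<alpha> r')" for x
    proof -
      define C where "C = A(j := A j + x *\<^sub>R outer w)"
      have "C(i := T ** C i ** transpose T) = A'(j := A' j + x *\<^sub>R outer w')"
        by (auto simp: C_def A'_def w'_def fun_eq_iff conjugate_add_scaleR conjugate_outer)
      then have "?q C = smult (1 - \<alpha>) (p A + smult x r) + smult \<alpha> (p A' + smult x r')"
        using r(3)[of x] r'(3)[of x] by (simp add: swap_average_def T_def[symmetric] C_def[symmetric])
      then show ?thesis
        unfolding C_def q by (simp add: smult_add_right mult.commute)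
    qed
    moreover have "degree (smult (1 - \<alpha>) r + smult \<alpha> r') \<le> CARD('n) - 1"
      using r(1) r'(1) by (intro degree_add_le) (auto intro: order_trans[OF degree_smult_le])
    moreover have "coeff (smult (1 - \<alpha>) r + smult \<alpha> r') (CARD('n) - 1) < 0"
    proof (cases "\<alpha> = 0")
      case False
      then show ?thesis using r(2) r'(2) \<alpha>
        by (simp del: One_nat_def add: add_nonpos_neg mult_nonneg_nonpos mult_pos_neg)
    qed (use r(2) in simp)
    ultimately show ?thesis by blast
  qed
  then show "upper_stable (?q A) \<and> degree (?q A) = CARD('n) \<and> lead_coeff (?q A) = 1 \<and>
     (\<forall>i\<in>I. \<forall>w. w \<noteq> 0 \<longrightarrow>
        (\<exists>r. degree r \<le> CARD('n) - 1 \<and> coeff r (CARD('n) - 1) < 0 \<and>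
           (\<forall>t. ?q (A(i := A i + t *\<^sub>R outer w)) = ?q A + smult t r)))"
    using upper_stable_swap_average[OF p A i st \<alpha>] deg by blast
qed

lemma kth_largest_root_swap_average:
  fixes p :: "(nat \<Rightarrow> real^'n^'n) \<Rightarrow> real poly"
  assumes p: "determinant_like I p" and A: "symmetric_tuple A" and i: "i \<in> I" and st: "s \<noteq> t"
    and \<alpha>: "0 \<le> \<alpha>" "\<alpha> \<le> 1" and k: "1 \<le> k" "k \<le> CARD('n)"
  defines "T \<equiv> perm_matrix (Transposition.transpose s t)"
  shows "kth_largest_root k (p A) \<le> kth_largest_root k (swap_average i s t \<alpha> p A) \<or>
    kth_largest_root k (p (A(i := T ** A i ** transpose T))) \<le> kth_largest_root k (swap_average i s t \<alpha> p A)"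
proof -
  have "symmetric_tuple (A(i := T ** A i ** transpose T))"
    using A by (rule symmetric_tuple_upd_conjugate)
  with p A have deg: "lead_coeff (p A) = 1" "lead_coeff (p (A(i := T ** A i ** transpose T))) = 1"
    "degree (p A) = CARD('n)" "degree (p (A(i := T ** A i ** transpose T))) = CARD('n)"
    unfolding determinant_like_def by blast+
  show ?thesis
    unfolding swap_average_def T_def[symmetric]
    using upper_stable_swap_average[OF p A i st] deg k \<alpha>
    by (intro kth_largest_root_convex_combination) (simp_all add: swap_average_def T_def)
qed

subsection \<open>Laws of products of random swaps\<close>

text \<open>Laws of finite products of independent random swaps, the newest factor on the
  left.\<close>

inductive swap_law :: "(real^'n^'n) pmf \<Rightarrow> bool" where
  swap_law_id: "swap_law (return_pmf (mat 1))"
| swap_law_swap: "swap_law \<mu> \<Longrightarrow> s \<noteq> t \<Longrightarrow> 0 \<le> \<alpha> \<Longrightarrow> \<alpha> \<le> 1 \<Longrightarrow>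
    swap_law (bind_pmf (bernoulli_pmf \<alpha>) (\<lambda>b. map_pmf
      (\<lambda>X. if b then perm_matrix (Transposition.transpose s t) ** X else X) \<mu>))"

text \<open>Every step alters one entry only, so a single induction runs over the swaps of all
  matrices together.\<close>

inductive swap_tuple_law :: "nat set \<Rightarrow> (nat \<Rightarrow> real^'n^'n) pmf \<Rightarrow> bool" for I where
  swap_tuple_law_id: "swap_tuple_law I (return_pmf (\<lambda>_. mat 1))"
| swap_tuple_law_swap: "swap_tuple_law I \<nu> \<Longrightarrow> i \<in> I \<Longrightarrow> s \<noteq> t \<Longrightarrow> 0 \<le> \<alpha> \<Longrightarrow> \<alpha> \<le> 1 \<Longrightarrow>
    swap_tuple_law I (bind_pmf (bernoulli_pmf \<alpha>) (\<lambda>b. map_pmf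
      (\<lambda>X. if b then X(i := perm_matrix (Transposition.transpose s t) ** X i) else X) \<nu>))"

definition conjugate_tuple :: "(nat \<Rightarrow> real^'n^'n) \<Rightarrow> (nat \<Rightarrow> real^'n^'n) \<Rightarrow> nat \<Rightarrow> real^'n^'n" where
  "conjugate_tuple X A = (\<lambda>i. X i ** A i ** transpose (X i))"

lemma determinant_like_degree:
  "determinant_like I p \<Longrightarrow> symmetric_tuple A \<Longrightarrow> degree (p A :: real poly) = CARD('n)"
  for A :: "nat \<Rightarrow> real^'n^'n"
  unfolding determinant_like_def by blast

lemma symmetric_conjugate_tuple: "symmetric_tuple A \<Longrightarrow> symmetric_tuple (conjugate_tuple X A)"
  by (simp add: symmetric_tuple_def conjugate_tuple_def transpose_conjugate)

lemma conjugate_tuple_upd: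
  "conjugate_tuple (X(i := T ** X i)) A =
    (conjugate_tuple X A)(i := T ** conjugate_tuple X A i ** transpose T)"
  by (auto simp: conjugate_tuple_def fun_eq_iff matrix_transpose_mul matrix_mul_assoc)

lemma finite_swap_tuple_law: "swap_tuple_law I \<nu> \<Longrightarrow> finite (set_pmf \<nu>)"
  by (induction rule: swap_tuple_law.induct) auto

text \<open>Conditioning on the coin splits the expectation. Finite support makes the integrals
  exist, and the degree bound lets \<open>expected_poly\<close> be computed coefficientwise.\<close>

lemma expected_poly_bernoulli_bind:
  assumes fin: "finite (set_pmf \<nu>)" and deg: "\<And>x. degree (f x) \<le> D" and \<alpha>: "0 \<le> \<alpha>" "\<alpha> \<le> 1"
  shows "expected_poly (measure_pmf (bind_pmf (bernoulli_pmf \<alpha>) (\<lambda>b. map_pmf (\<lambda>x. if b then h x else x) \<nu>))) f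
    = expected_poly (measure_pmf \<nu>) (\<lambda>x. smult (1 - \<alpha>) (f x) + smult \<alpha> (f (h x)))"
proof (rule poly_eqI)
  fix j
  let ?\<nu> = "\<lambda>b. map_pmf (\<lambda>x. if b then h x else x) \<nu>"
  have int: "integrable (measure_pmf \<nu>) g" for g :: "_ \<Rightarrow> real"
    using fin by (rule integrable_measure_pmf_finite)
  have "measure_pmf.expectation (bind_pmf (bernoulli_pmf \<alpha>) ?\<nu>) (\<lambda>x. coeff (f x) j)
      = (\<Sum>b\<in>UNIV. pmf (bernoulli_pmf \<alpha>) b *\<^sub>R measure_pmf.expectation (?\<nu> b) (\<lambda>x. coeff (f x) j))"
    using fin by (intro pmf_expectation_bind) auto
  also have "\<dots> = (1 - \<alpha>) * measure_pmf.expectation \<nu> (\<lambda>x. coeff (f x) j)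
      + \<alpha> * measure_pmf.expectation \<nu> (\<lambda>x. coeff (f (h x)) j)"
    using \<alpha> by (simp add: UNIV_bool)
  also have "\<dots> = measure_pmf.expectation \<nu> (\<lambda>x. coeff (smult (1 - \<alpha>) (f x) + smult \<alpha> (f (h x))) j)"
    by (simp add: int)
  finally show "coeff (expected_poly (measure_pmf (bind_pmf (bernoulli_pmf \<alpha>) ?\<nu>)) f) j
    = coeff (expected_poly (measure_pmf \<nu>) (\<lambda>x. smult (1 - \<alpha>) (f x) + smult \<alpha> (f (h x)))) j"
    by (subst (1 2) coeff_expected_poly[where D = D])
      (auto intro!: deg degree_add_le order_trans[OF degree_smult_le])
qed

text \<open>The last swap is averaged into the functional, giving another determinant-like
  \<open>q\<close> for the induction hypothesis; hence \<open>p\<close> is generalized. The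
  hypothesis yields an outcome \<open>X\<close> of the earlier swaps, after which an outcome of the
  last swap stays below the average.\<close>

lemma kth_largest_root_expected_poly:
  fixes p :: "(nat \<Rightarrow> real^'n^'n) \<Rightarrow> real poly"
  assumes "swap_tuple_law I \<nu>" "determinant_like I p" "symmetric_tuple A" and k: "1 \<le> k" "k \<le> CARD('n)"
  shows "\<exists>X\<in>set_pmf \<nu>. kth_largest_root k (p (conjugate_tuple X A))
    \<le> kth_largest_root k (expected_poly (measure_pmf \<nu>) (\<lambda>X. p (conjugate_tuple X A)))"
  using assms(1-3)
proof (induction arbitrary: p rule: swap_tuple_law.induct)
  case swap_tuple_law_id
  have "degree (p (conjugate_tuple X A)) \<le> CARD('n)" for X
    using determinant_like_degree[OF swap_tuple_law_id(1) symmetric_conjugate_tuple[OF swap_tuple_law_id(2)]] by simp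
  then have "expected_poly (measure_pmf (return_pmf (\<lambda>_. mat 1))) (\<lambda>X. p (conjugate_tuple X A))
      = p (conjugate_tuple (\<lambda>_. mat 1) A)"
    by (intro poly_eqI) (subst coeff_expected_poly, auto)
  then show ?case by simp
next
  case (swap_tuple_law_swap \<nu> i s t \<alpha>)
  define T where "T = perm_matrix (Transposition.transpose s t)"
  define h where "h X = X(i := T ** X i)" for X :: "nat \<Rightarrow> real^'n^'n"
  define q where "q = swap_average i s t \<alpha> p"
  have q: "determinant_like I q"
    unfolding q_def using swap_tuple_law_swap by (intro determinant_like_swap_average)
  have deg: "degree (p (conjugate_tuple X A)) \<le> CARD('n)" for X
    using determinant_like_degree[OF swap_tuple_law_swap.prems(1) symmetric_conjugate_tuple[OF swap_tuple_law_swap.prems(2)]]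
    by simp
  have pq: "smult (1 - \<alpha>) (p (conjugate_tuple X A)) + smult \<alpha> (p (conjugate_tuple (h X) A)) = q (conjugate_tuple X A)" for X
    by (simp add: q_def swap_average_def h_def conjugate_tuple_upd T_def)
  let ?\<nu> = "bind_pmf (bernoulli_pmf \<alpha>) (\<lambda>b. map_pmf (\<lambda>X. if b then h X else X) \<nu>)"
  have E: "expected_poly (measure_pmf ?\<nu>) (\<lambda>X. p (conjugate_tuple X A))
     = expected_poly (measure_pmf \<nu>) (\<lambda>X. q (conjugate_tuple X A))"
    using finite_swap_tuple_law[OF swap_tuple_law_swap.hyps(1)] swap_tuple_law_swap.hyps(4,5)
    by (subst expected_poly_bernoulli_bind[OF _ deg]) (auto simp: pq)
  obtain X where X: "X \<in> set_pmf \<nu>" "kth_largest_root k (q (conjugate_tuple X A))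
    \<le> kth_largest_root k (expected_poly (measure_pmf \<nu>) (\<lambda>X. q (conjugate_tuple X A)))"
    using swap_tuple_law_swap.IH[OF q swap_tuple_law_swap.prems(2)] by blast
  have "\<exists>Y\<in>set_pmf ?\<nu>. kth_largest_root k (p (conjugate_tuple Y A)) \<le> kth_largest_root k (q (conjugate_tuple X A))"
  proof -
    have hX: "h X \<in> set_pmf ?\<nu>" if "\<alpha> \<noteq> 0"
      using that X(1) swap_tuple_law_swap.hyps(4,5)
      by (auto simp: set_pmf_iff[of _ "bernoulli_pmf \<alpha>"] intro!: bexI[of _ True])
    have X': "X \<in> set_pmf ?\<nu>" if "\<alpha> \<noteq> 1"
      using that X(1) swap_tuple_law_swap.hyps(4,5)
      by (auto simp: set_pmf_iff[of _ "bernoulli_pmf \<alpha>"] intro!: bexI[of _ False])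
    \<comment> \<open>For \<open>\<alpha>\<close> equal to 0 or 1 the swap is deterministic: the
      average is the value of \<open>p\<close> at its sure outcome, and only that outcome is known
      to lie in the support.\<close>
    consider "\<alpha> = 0" | "\<alpha> = 1" | "\<alpha> \<noteq> 0" "\<alpha> \<noteq> 1" by blast
    then show ?thesis
    proof cases
      case 1
      then show ?thesis using X' pq[of X] by (intro bexI[of _ X]) auto
    next
      case 2
      then show ?thesis using hX pq[of X] by (intro bexI[of _ "h X"]) auto
    next
      case 3
      have "kth_largest_root k (p (conjugate_tuple X A)) \<le> kth_largest_root k (q (conjugate_tuple X A)) \<or>
         kth_largest_root k (p (conjugate_tuple (h X) A)) \<le> kth_largest_root k (q (conjugate_tuple X A))"
        using kth_largest_root_swap_average[OF swap_tuple_law_swap.prems(1)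
            symmetric_conjugate_tuple[OF swap_tuple_law_swap.prems(2)] swap_tuple_law_swap.hyps(2-5) k]
        unfolding q_def h_def conjugate_tuple_upd T_def .
      then show ?thesis using hX X' 3 by blast
    qed
  qed
  then show ?case
    using X(2) unfolding E[symmetric] h_def T_def by (meson order_trans)
qed

text \<open>By associativity each swap factor of \<open>Y\<close> becomes a swap acting on entry
  \<open>i\<close>, so induction on the law of \<open>Y\<close> applies.\<close>

lemma swap_tuple_law_extend:
  fixes \<nu> :: "(nat \<Rightarrow> real^'n^'n) pmf"
  assumes "swap_law \<mu>" "swap_tuple_law I \<nu>" "i \<in> I"
  shows "swap_tuple_law I (bind_pmf \<mu> (\<lambda>Y. map_pmf (\<lambda>X. X(i := Y ** X i)) \<nu>))"
  using assms(1)
proof (induction rule: swap_law.induct)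
  case swap_law_id
  have "(\<lambda>X. X(i := mat 1 ** X i)) = (id :: (nat \<Rightarrow> real^'n^'n) \<Rightarrow> _)" by (simp add: fun_eq_iff)
  then show ?case using assms(2) by (simp only: bind_return_pmf pmf.map_id)
next
  case (swap_law_swap \<mu> s t \<alpha>)
  define T where "T = perm_matrix (Transposition.transpose s t)"
  let ?\<nu> = "bind_pmf \<mu> (\<lambda>Y. map_pmf (\<lambda>X. X(i := Y ** X i)) \<nu>)"
  have "bind_pmf (bind_pmf (bernoulli_pmf \<alpha>) (\<lambda>b. map_pmf (\<lambda>X. if b then T ** X else X) \<mu>))
      (\<lambda>Y. map_pmf (\<lambda>X. X(i := Y ** X i)) \<nu>)
    = bind_pmf (bernoulli_pmf \<alpha>) (\<lambda>b. map_pmf (\<lambda>X. if b then X(i := T ** X i) else X) ?\<nu>)"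
    unfolding bind_assoc_pmf
  proof (intro bind_pmf_cong refl)
    fix b
    show "bind_pmf (map_pmf (\<lambda>X. if b then T ** X else X) \<mu>) (\<lambda>Y. map_pmf (\<lambda>X. X(i := Y ** X i)) \<nu>)
      = map_pmf (\<lambda>X. if b then X(i := T ** X i) else X) ?\<nu>"
      by (cases b) (simp_all add: bind_map_pmf map_bind_pmf map_pmf_comp matrix_mul_assoc)
  qed
  moreover have "swap_tuple_law I (bind_pmf (bernoulli_pmf \<alpha>) (\<lambda>b. map_pmf (\<lambda>X. if b then X(i := T ** X i) else X) ?\<nu>))"
    unfolding T_def using swap_law_swap assms(3) by (intro swap_tuple_law_swap)
  ultimately show ?case unfolding T_def by (simp only:)
qed

lemma swap_tuple_law_Pi_pmf:
  assumes "finite J" "J \<subseteq> I" "\<And>i. i \<in> J \<Longrightarrow> swap_law (\<mu> i)"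
  shows "swap_tuple_law I (Pi_pmf J (mat 1) \<mu>)"
  using assms
proof (induction J rule: finite_induct)
  case empty
  then show ?case by (simp add: swap_tuple_law_id)
next
  case (insert i J)
  let ?\<nu> = "Pi_pmf J (mat 1) \<mu>"
  have "Pi_pmf (insert i J) (mat 1) \<mu> = bind_pmf (\<mu> i) (\<lambda>Y. map_pmf (\<lambda>X. X(i := Y)) ?\<nu>)"
    using insert.hyps by (simp add: Pi_pmf_insert pair_pmf_def map_bind_pmf map_pmf_def bind_assoc_pmf bind_return_pmf)
  \<comment> \<open>Entry \<open>i\<close> still has the default value \<open>mat 1\<close>, so
    assigning \<open>Y\<close> agrees with multiplying by \<open>Y\<close>.\<close>
  also have "\<dots> = bind_pmf (\<mu> i) (\<lambda>Y. map_pmf (\<lambda>X. X(i := Y ** X i)) ?\<nu>)"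
  proof (intro bind_pmf_cong map_pmf_cong refl)
    fix Y X assume "X \<in> set_pmf ?\<nu>"
    then have "X i = mat 1" using insert.hyps set_Pi_pmf_subset[of J "mat 1" \<mu>] by auto
    then show "X(i := Y) = X(i := Y ** X i)" by simp
  qed
  also have "swap_tuple_law I \<dots>"
    using insert by (intro swap_tuple_law_extend) auto
  finally show ?case .
qed

section \<open>From random matrices to finite laws\<close>

lemma measurable_swap_product:
  assumes "n \<le> N"
  shows "(\<lambda>f. swap_product f n :: real^'n^'n) \<in> borel_measurable (PiM {1..N} (\<lambda>_. borel))"
  using assms
proof (induction n)
  case (Suc n)
  have "(\<lambda>f. f (Suc n)) \<in> borel_measurable (PiM {1..N} (\<lambda>_. borel :: (real^'n^'n) measure))"
    using Suc.prems by (intro measurable_component_singleton) auto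
  moreover have "continuous_on UNIV (\<lambda>x :: (real^'n^'n) \<times> (real^'n^'n). fst x ** snd x)"
    unfolding matrix_matrix_mult_def by (intro continuous_intros)
  ultimately show ?case
    using Suc by (simp add: borel_measurable_continuous_Pair[where H = "(**)"])
qed simp

lemma perm_matrix_transpose_involution:
  "perm_matrix (Transposition.transpose s t) ** perm_matrix (Transposition.transpose s t) = (mat 1 :: real^'n^'n)"
  by (auto simp: vec_eq_iff matrix_matrix_mult_def perm_matrix_def mat_def if_distrib[of "\<lambda>x. _ * x"] cong: if_cong)

text \<open>Point probabilities satisfy the recursion that defines \<open>swap_law\<close>, because
  the new swap is independent of the product of the earlier ones.\<close>

lemma (in prob_space) swap_law_swap_product:
  fixes S :: "nat \<Rightarrow> 'a \<Rightarrow> real^'n^'n"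
  assumes ind: "indep_vars (\<lambda>_. borel) S {1..N}" and swap: "\<And>i. i \<in> {1..N} \<Longrightarrow> random_swap M (S i)"
    and "n \<le> N"
  shows "\<exists>\<mu>. swap_law \<mu> \<and> (\<forall>Y. prob {\<omega>\<in>space M. swap_product (\<lambda>i. S i \<omega>) n = Y} = pmf \<mu> Y)"
  using \<open>n \<le> N\<close>
proof (induction n)
  case 0
  show ?case
    by (intro exI[of _ "return_pmf (mat 1)"]) (auto simp: swap_law_id pmf_return prob_space indicator_def)
next
  case (Suc n)
  define X where "X \<omega> = swap_product (\<lambda>i. S i \<omega>) n" for \<omega>
  obtain \<mu> where \<mu>: "swap_law \<mu>" "\<And>Y. prob {\<omega>\<in>space M. X \<omega> = Y} = pmf \<mu> Y"
    using Suc unfolding X_def by auto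
  have rv: "S i \<in> borel_measurable M" if "i \<in> {1..N}" for i
    using swap[OF that] by (simp add: random_swap_def)
  have S: "S (Suc n) \<in> borel_measurable M" using Suc.prems by (intro rv) auto
  obtain s t \<alpha> where st: "s \<noteq> t" "0 \<le> \<alpha>" "\<alpha> \<le> 1"
    "prob {\<omega>\<in>space M. S (Suc n) \<omega> = perm_matrix (Transposition.transpose s t)} = \<alpha>"
    "prob {\<omega>\<in>space M. S (Suc n) \<omega> = mat 1} = 1 - \<alpha>"
  proof -
    have "random_swap M (S (Suc n))" using Suc.prems by (intro swap) auto
    then show ?thesis unfolding random_swap_def using that by blast
  qed
  define T :: "real^'n^'n" where "T = perm_matrix (Transposition.transpose s t)"
  have TT: "T ** T = mat 1" unfolding T_def by (rule perm_matrix_transpose_involution)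
  \<comment> \<open>The \<open>(s, t)\<close> entry separates the two values of the swap, so their
    events are disjoint and the probabilities add.\<close>
  have "T $ s $ t \<noteq> mat 1 $ s $ t" using st(1) by (simp add: T_def perm_matrix_def mat_def)
  then have T1: "T \<noteq> mat 1" by auto
  \<comment> \<open>The product of the first \<open>n\<close> swaps depends on the indices up to
    \<open>n\<close> only, and subfamilies over disjoint index sets are independent.\<close>
  have "indep_var borel ((\<lambda>f. f (Suc n)) \<circ> (\<lambda>\<omega>. restrict (\<lambda>i. S i \<omega>) {Suc n}))
     borel ((\<lambda>f. swap_product f n) \<circ> (\<lambda>\<omega>. restrict (\<lambda>i. S i \<omega>) {1..n}))"
    using Suc.prems
    by (intro indep_var_compose[OF indep_var_restrict[OF ind]] measurable_swap_product measurable_component_singleton) auto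
  moreover have "(\<lambda>f. swap_product f n) \<circ> (\<lambda>\<omega>. restrict (\<lambda>i. S i \<omega>) {1..n}) = X"
    by (auto simp: X_def fun_eq_iff intro!: swap_product_cong)
  ultimately have iv: "indep_var borel (S (Suc n)) borel X"
    by (simp add: comp_def)
  then have X: "X \<in> borel_measurable M" by (simp add: indep_var_rv2)
  have joint: "prob {\<omega>\<in>space M. S (Suc n) \<omega> = U \<and> X \<omega> = V} = prob {\<omega>\<in>space M. S (Suc n) \<omega> = U} * pmf \<mu> V" for U V
    using indep_varD[OF iv, of "{U}" "{V}"] \<mu>(2)[of V]
    by (simp add: vimage_def Int_def conj_commute)
  have ev: "{\<omega>\<in>space M. S (Suc n) \<omega> = U} \<in> events" "{\<omega>\<in>space M. X \<omega> = V} \<in> events" for U V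
    using S X by measurable
  \<comment> \<open>A random swap is specified by two point masses. They add up to 1, so any other
    value occurs on a null set.\<close>
  have "AE \<omega> in M. S (Suc n) \<omega> = T \<or> S (Suc n) \<omega> = mat 1"
  proof -
    have "prob ({\<omega>\<in>space M. S (Suc n) \<omega> = T} \<union> {\<omega>\<in>space M. S (Suc n) \<omega> = mat 1}) = \<alpha> + (1 - \<alpha>)"
      using T1 ev st(4,5) unfolding T_def[symmetric] by (subst finite_measure_Union) auto
    then show ?thesis
      using AE_prob_1[of "{\<omega>\<in>space M. S (Suc n) \<omega> = T} \<union> {\<omega>\<in>space M. S (Suc n) \<omega> = mat 1}"] by auto
  qed
  then have AE: "AE \<omega> in M. S (Suc n) \<omega> ** X \<omega> = Y \<longleftrightarrow>
      (S (Suc n) \<omega> = T \<and> X \<omega> = T ** Y) \<or> (S (Suc n) \<omega> = mat 1 \<and> X \<omega> = Y)" for Y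
  proof eventually_elim
    case (elim \<omega>)
    have "T ** X \<omega> = Y \<longleftrightarrow> X \<omega> = T ** Y"
      using TT by (metis matrix_mul_assoc matrix_mul_lid)
    then show ?case using elim T1 by auto
  qed
  define \<mu>' where "\<mu>' = bind_pmf (bernoulli_pmf \<alpha>) (\<lambda>b. map_pmf (\<lambda>X. if b then T ** X else X) \<mu>)"
  have "swap_law \<mu>'"
    unfolding \<mu>'_def T_def using \<mu>(1) st by (intro swap_law_swap)
  moreover have "prob {\<omega>\<in>space M. swap_product (\<lambda>i. S i \<omega>) (Suc n) = Y} = pmf \<mu>' Y" for Y
  proof -
    have cont: "continuous_on UNIV (\<lambda>x :: (real^'n^'n) \<times> (real^'n^'n). fst x ** snd x)"
      unfolding matrix_matrix_mult_def by (intro continuous_intros)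
    have SX: "(\<lambda>\<omega>. S (Suc n) \<omega> ** X \<omega>) \<in> borel_measurable M"
      using borel_measurable_continuous_Pair[OF S X, of "(**)"] cont by simp
    have ev2: "{\<omega>\<in>space M. S (Suc n) \<omega> = U \<and> X \<omega> = V} \<in> events" for U V
      using S X by measurable
    have "prob {\<omega>\<in>space M. S (Suc n) \<omega> ** X \<omega> = Y}
      = prob ({\<omega>\<in>space M. S (Suc n) \<omega> = T \<and> X \<omega> = T ** Y} \<union> {\<omega>\<in>space M. S (Suc n) \<omega> = mat 1 \<and> X \<omega> = Y})"
    proof (rule finite_measure_eq_AE)
      show "AE \<omega> in M. (\<omega> \<in> {\<omega>\<in>space M. S (Suc n) \<omega> ** X \<omega> = Y}) = 
        (\<omega> \<in> {\<omega>\<in>space M. S (Suc n) \<omega> = T \<and> X \<omega> = T ** Y} \<union> {\<omega>\<in>space M. S (Suc n) \<omega> = mat 1 \<and> X \<omega> = Y})"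
        using AE[of Y] by eventually_elim auto
      show "{\<omega>\<in>space M. S (Suc n) \<omega> ** X \<omega> = Y} \<in> events"
        using SX by measurable
    qed (use ev2 in auto)
    also have "\<dots> = \<alpha> * pmf \<mu> (T ** Y) + (1 - \<alpha>) * pmf \<mu> Y"
      using T1 ev2 st(4,5) unfolding T_def[symmetric]
      by (subst finite_measure_Union) (auto simp: joint)
    also have "\<dots> = pmf \<mu>' Y"
    proof -
      have "inj ((**) T)" by (rule injI) (metis TT matrix_mul_assoc matrix_mul_lid)
      then have "pmf (map_pmf ((**) T) \<mu>) (T ** (T ** Y)) = pmf \<mu> (T ** Y)"
        by (rule pmf_map_inj')
      then show ?thesis
        using st(2,3) by (simp add: \<mu>'_def pmf_bind matrix_mul_assoc TT mult.commute)
    qed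
    finally show ?thesis by (simp add: X_def)
  qed
  ultimately show ?case by blast
qed

text \<open>Singleton probabilities depend only on the distribution, so the law computed on the
  auxiliary space \<open>Q\<close> carries over to \<open>M\<close>.\<close>

lemma swap_law_realizable:
  fixes P :: "'a \<Rightarrow> real^'n^'n"
  assumes P: "P \<in> borel_measurable M" and "realizable_by_swaps M P"
  shows "\<exists>\<mu>. swap_law \<mu> \<and> (\<forall>Y. measure M {\<omega>\<in>space M. P \<omega> = Y} = pmf \<mu> Y)"
proof -
  obtain N and Q :: "(nat \<Rightarrow> real^'n^'n) measure" and S where Q: "prob_space Q"
    "prob_space.indep_vars Q (\<lambda>_. borel) S {1..N}" "\<And>i. i \<in> {1..N} \<Longrightarrow> random_swap Q (S i)"
    "distr M borel P = distr Q borel (\<lambda>\<omega>. swap_product (\<lambda>i. S i \<omega>) N)"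
    using assms(2) unfolding realizable_by_swaps_def by blast
  interpret Q: prob_space Q by fact
  obtain \<mu> where \<mu>: "swap_law \<mu>"
    "\<And>Y. measure Q {\<omega>\<in>space Q. swap_product (\<lambda>i. S i \<omega>) N = Y} = pmf \<mu> Y"
    using Q.swap_law_swap_product[OF Q(2,3), of N] by auto
  have rv: "S i \<in> borel_measurable Q" if "i \<in> {1..N}" for i
    using Q(3)[OF that] by (simp add: random_swap_def)
  have "(\<lambda>\<omega>. restrict (\<lambda>i. S i \<omega>) {1..N}) \<in> measurable Q (PiM {1..N} (\<lambda>_. borel))"
    by (intro measurable_restrict rv)
  from measurable_compose[OF this measurable_swap_product[OF order_refl]]
  have "(\<lambda>\<omega>. swap_product (restrict (\<lambda>i. S i \<omega>) {1..N}) N) \<in> borel_measurable Q" .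
  also have "(\<lambda>\<omega>. swap_product (restrict (\<lambda>i. S i \<omega>) {1..N}) N) = (\<lambda>\<omega>. swap_product (\<lambda>i. S i \<omega>) N)"
    by (intro ext swap_product_cong) auto
  finally have S: "(\<lambda>\<omega>. swap_product (\<lambda>i. S i \<omega>) N) \<in> borel_measurable Q" .
  have "measure M {\<omega>\<in>space M. P \<omega> = Y} = pmf \<mu> Y" for Y
  proof -
    have "measure M {\<omega>\<in>space M. P \<omega> = Y} = measure (distr M borel P) {Y}"
      using P by (subst measure_distr) (auto simp: vimage_def Int_def conj_commute)
    also have "\<dots> = measure Q {\<omega>\<in>space Q. swap_product (\<lambda>i. S i \<omega>) N = Y}"
      unfolding Q(4) using S by (subst measure_distr) (auto simp: vimage_def Int_def conj_commute)
    finally show ?thesis using \<mu>(2) by simp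
  qed
  then show ?thesis using \<mu>(1) by blast
qed

text \<open>Finitely many measurable level sets take the place of a sigma-algebra on the values of
  \<open>F\<close>; both integrals become the same finite sum.\<close>

lemma (in prob_space) integral_finite_range_pmf:
  fixes g :: "'b \<Rightarrow> real"
  assumes K: "finite K" "\<And>\<omega>. \<omega> \<in> space M \<Longrightarrow> F \<omega> \<in> K"
    and ev: "\<And>x. x \<in> K \<Longrightarrow> {\<omega>\<in>space M. F \<omega> = x} \<in> events"
    and pmf: "\<And>x. prob {\<omega>\<in>space M. F \<omega> = x} = pmf \<nu> x"
  shows "(\<integral>\<omega>. g (F \<omega>) \<partial>M) = measure_pmf.expectation \<nu> g"
proof -
  have sub: "set_pmf \<nu> \<subseteq> K"
  proof
    fix x assume x: "x \<in> set_pmf \<nu>"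
    show "x \<in> K"
    proof (rule ccontr)
      assume "x \<notin> K"
      then have "{\<omega>\<in>space M. F \<omega> = x} = {}" using K(2) by auto
      then have "pmf \<nu> x = 0" using pmf[of x] by (simp only: measure_empty)
      then show False using x by (simp add: set_pmf_iff)
    qed
  qed
  have "(\<integral>\<omega>. g (F \<omega>) \<partial>M) = (\<integral>\<omega>. (\<Sum>x\<in>K. g x * indicator {\<omega>\<in>space M. F \<omega> = x} \<omega>) \<partial>M)"
  proof (rule Bochner_Integration.integral_cong[OF refl])
    fix \<omega> assume \<omega>: "\<omega> \<in> space M"
    have "(\<Sum>x\<in>K. g x * indicator {\<omega>\<in>space M. F \<omega> = x} \<omega>) = (\<Sum>x\<in>K. if x = F \<omega> then g x else 0)"
      using \<omega> by (intro sum.cong) (auto simp: indicator_def)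
    then show "g (F \<omega>) = (\<Sum>x\<in>K. g x * indicator {\<omega>\<in>space M. F \<omega> = x} \<omega>)"
      using K \<omega> by simp
  qed
  also have "\<dots> = (\<Sum>x\<in>K. g x * pmf \<nu> x)"
    using ev by (subst Bochner_Integration.integral_sum) (auto simp: pmf[symmetric] emeasure_eq_measure)
  also have "\<dots> = measure_pmf.expectation \<nu> g"
    using K(1) sub by (subst integral_measure_pmf[of K]) (auto simp: mult.commute)
  finally show ?thesis .
qed

section \<open>The bound for independent random permutation matrices\<close>

theorem theorem3p4:
  fixes M :: "'a measure"
    and A :: "nat \<Rightarrow> real^'n^'n"
    and P :: "nat \<Rightarrow> 'a \<Rightarrow> real^'n^'n"
    and m k :: nat
  assumes "prob_space M"
    and "\<And>i. i \<in> {1..m} \<Longrightarrow> transpose (A i) = A i"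
    and "\<And>i. i \<in> {1..m} \<Longrightarrow> random_permutation_matrix M (P i)"
    and "\<And>i. i \<in> {1..m} \<Longrightarrow> realizable_by_swaps M (P i)"
    and "prob_space.indep_vars M (\<lambda>_. borel) P {1..m}"
    and "1 \<le> k" and "k \<le> CARD('n)"
  shows "measure M {\<omega>\<in>space M.
           kth_largest_eigenvalue k (\<Sum>i=1..m. P i \<omega> ** A i ** transpose (P i \<omega>))
             \<le> kth_largest_root k
                 (expected_poly M (\<lambda>\<omega>. charpoly (\<Sum>i=1..m. P i \<omega> ** A i ** transpose (P i \<omega>))))} > 0"
proof -
  interpret prob_space M by fact
  have rv: "P i \<in> borel_measurable M" if "i \<in> {1..m}" for i
    using assms(3)[OF that] by (simp add: random_permutation_matrix_def)
  obtain \<mu> where \<mu>: "\<And>i. i \<in> {1..m} \<Longrightarrow> swap_law (\<mu> i)"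
    "\<And>i Y. i \<in> {1..m} \<Longrightarrow> prob {\<omega>\<in>space M. P i \<omega> = Y} = pmf (\<mu> i) Y"
    using swap_law_realizable[OF rv assms(4)] by metis
  define \<nu> where "\<nu> = Pi_pmf {1..m} (mat 1) \<mu>"
  \<comment> \<open>Outside the index range \<open>F\<close> takes the default value of
    \<open>Pi_pmf\<close>, and \<open>A'\<close> is zero to be symmetric at every index; the sum
    over \<open>{1..m}\<close> does not see either choice.\<close>
  define F where "F \<omega> = (\<lambda>i. if i \<in> {1..m} then P i \<omega> else mat 1)" for \<omega>
  define A' where "A' = (\<lambda>i. if i \<in> {1..m} then A i else 0)"
  define p where "p = (\<lambda>A. charpoly (\<Sum>i=1..m. A i :: real^'n^'n))"
  define K where "K = {X. (\<forall>i. X i \<in> (if i \<in> {1..m} then range perm_matrix else {mat 1 :: real^'n^'n}))}"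
  have "K = PiE_dflt {1..m} (mat 1) (\<lambda>_. range perm_matrix)"
    by (auto simp: K_def PiE_dflt_def split: if_splits)
  then have K: "finite K" by (simp add: finite_PiE_dflt)
  have FK: "F \<omega> \<in> K" if "\<omega> \<in> space M" for \<omega>
    using assms(3) that by (fastforce simp: K_def F_def random_permutation_matrix_def)
  have ev: "{\<omega>\<in>space M. F \<omega> = X} \<in> events" if "X \<in> K" for X
  proof -
    have "{\<omega>\<in>space M. F \<omega> = X} = {\<omega>\<in>space M. \<forall>i\<in>{1..m}. P i \<omega> = X i}"
      using that by (fastforce simp: F_def K_def fun_eq_iff split: if_splits)
    also have "\<dots> \<in> events"
      using rv by (intro sets.sets_Collect_finite_All) auto
    finally show ?thesis .
  qed
  have law: "prob {\<omega>\<in>space M. F \<omega> = X} = pmf \<nu> X" for X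
  proof (cases "\<forall>i. i \<notin> {1..m} \<longrightarrow> X i = mat 1")
    case False
    then have "{\<omega>\<in>space M. F \<omega> = X} = {}" by (auto simp: F_def)
    then have "prob {\<omega>\<in>space M. F \<omega> = X} = 0" by (simp only: measure_empty)
    then show ?thesis using False by (auto simp: \<nu>_def pmf_Pi)
  next
    case True
    \<comment> \<open>Independence gives the product formula for a nonempty index set; for
      \<open>m = 0\<close> both sides are 1.\<close>
    have "prob {\<omega>\<in>space M. F \<omega> = X} = (\<Prod>i\<in>{1..m}. pmf (\<mu> i) (X i))"
    proof (cases "m = 0")
      case True
      then have "{\<omega>\<in>space M. F \<omega> = X} = space M"
        using \<open>\<forall>i. i \<notin> {1..m} \<longrightarrow> X i = mat 1\<close> by (auto simp: F_def)
      then show ?thesis using True by (simp add: prob_space)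
    next
      case False
      have "{\<omega>\<in>space M. F \<omega> = X} = (\<Inter>i\<in>{1..m}. P i -` {X i} \<inter> space M)"
        using False \<open>\<forall>i. i \<notin> {1..m} \<longrightarrow> X i = mat 1\<close> by (auto simp: F_def fun_eq_iff)
      also have "prob \<dots> = (\<Prod>i\<in>{1..m}. prob (P i -` {X i} \<inter> space M))"
        using False by (intro indep_varsD[OF assms(5)]) auto
      also have "\<dots> = (\<Prod>i\<in>{1..m}. pmf (\<mu> i) (X i))"
        by (intro prod.cong refl) (simp add: \<mu>(2)[symmetric] vimage_def Int_def conj_commute)
      finally show ?thesis .
    qed
    then show ?thesis using True by (simp add: \<nu>_def pmf_Pi)
  qed
  have p: "p (conjugate_tuple (F \<omega>) A') = charpoly (\<Sum>i=1..m. P i \<omega> ** A i ** transpose (P i \<omega>))" for \<omega>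
    unfolding p_def by (intro arg_cong[where f = charpoly] sum.cong) (auto simp: conjugate_tuple_def F_def A'_def)
  have E: "expected_poly M (\<lambda>\<omega>. charpoly (\<Sum>i=1..m. P i \<omega> ** A i ** transpose (P i \<omega>)))
    = expected_poly (measure_pmf \<nu>) (\<lambda>X. p (conjugate_tuple X A'))" (is "?E = _")
    unfolding p[symmetric] expected_poly_def
    by (intro arg_cong[where f = Abs_poly] ext
        integral_finite_range_pmf[OF K FK ev law, of "\<lambda>X. coeff (p (conjugate_tuple X A')) _"])
  have sym: "symmetric_tuple A'"
    using assms(2) by (auto simp: symmetric_tuple_def A'_def transpose_def vec_eq_iff)
  have "swap_tuple_law {1..m} \<nu>"
    unfolding \<nu>_def using \<mu>(1) by (intro swap_tuple_law_Pi_pmf) auto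
  then obtain X where X: "X \<in> set_pmf \<nu>"
    "kth_largest_root k (p (conjugate_tuple X A')) \<le> kth_largest_root k ?E"
    using kth_largest_root_expected_poly[OF _ determinant_like_charpoly_sum sym assms(6,7)]
    unfolding E p_def by blast
  \<comment> \<open>This event contains \<open>F \<omega> = X\<close>, which has positive
    probability. Monotonicity of the measure needs it to be measurable, which holds as it is a
    finite union of level sets.\<close>
  let ?G = "{\<omega>\<in>space M. kth_largest_root k (p (conjugate_tuple (F \<omega>) A')) \<le> kth_largest_root k ?E}"
  have "?G = (\<Union>Y\<in>{Y\<in>K. kth_largest_root k (p (conjugate_tuple Y A')) \<le> kth_largest_root k ?E}. {\<omega>\<in>space M. F \<omega> = Y})"
    using FK by auto
  also have "\<dots> \<in> events" using K ev by (intro sets.finite_UN) auto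
  finally have G: "?G \<in> events" .
  have "0 < pmf \<nu> X" using X(1) by (simp add: pmf_positive)
  also have "\<dots> = prob {\<omega>\<in>space M. F \<omega> = X}" by (rule law[symmetric])
  also have "\<dots> \<le> prob ?G" using X(2) by (intro finite_measure_mono G) auto
  finally show ?thesis
    unfolding kth_largest_eigenvalue_def p .
qed

end
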